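(* Let $K \subset \mathbb{R}^2$ be a compact set with positive logarithmic capacity, $C_{\log}(K)>0$. Let $M$ be a real $2\times 2$ area-preserving matrix (that is, $\det M = \pm 1$), and suppose $K$ has rotational symmetry of order $N$ for some integer $N \geq 3$. Then \[ C_{\log}(MK) \geq C_{\log}(K), \] with equality if and only if $M$ is orthogonal. In particular, if a compact set $K\subset\mathbb{R}^2$ has $N$-fold rotational symmetry (for some $N\ge 3$) and positive area, then it minimizes logarithmic capacity among all its linear images with the same area.
   Context: The logarithmic energy of a compact set $K \subset \mathbb{R}^2$ is \[ V_{\log}(K) = \min_\mu \int_K \int_K \log \frac{1}{|x-y|} \, d\mu(x)\, d\mu(y) \in (-\infty,+\infty], \] where the minimum is over all Borel probability measures $\mu$ on $K$ (the minimum is attained). The logarithmic capacity is $C_{\log}(K) = \exp(-V_{\log}(K)) \in [0,\infty)$, with value $0$ when $V_{\log}(K)=+\infty$. $K$ has rotational symmetry of order $N$ ($N$-fold rotational symmetry) if $RK=K$, where $R$ is the rotation of $\mathbb{R}^2$ about the origin by angle $2\pi/N$. Area means $2$-dimensional Lebesgue measure, and $MK=\{Mx : x\in K\}$. *)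

theory Defs
  imports "HOL-Analysis.Analysis" "HOL-Probability.Probability_Measure"
begin

text \<open>Lebesgue integral of an extended-real-valued function, as the integral of its positive part
  minus the integral of its negative part. The \<open>\<infinity> - \<infinity>\<close> case does not arise below: on a bounded set the
  logarithmic kernel is bounded from below, so its negative part has finite integral with respect
  to any probability measure, and likewise for the outer integral.\<close>

definition ereal_integral :: "'a measure \<Rightarrow> ('a \<Rightarrow> ereal) \<Rightarrow> ereal" where
  "ereal_integral \<mu> f =
     enn2ereal (\<integral>\<^sup>+ x. e2ennreal (f x) \<partial>\<mu>) - enn2ereal (\<integral>\<^sup>+ x. e2ennreal (- f x) \<partial>\<mu>)"

definition log_kernel :: "real ^ 2 \<Rightarrow> real ^ 2 \<Rightarrow> ereal" where
  "log_kernel x y = (if x = y then \<infinity> else ereal (ln (1 / norm (x - y))))"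

definition borel_prob_measures_on :: "(real ^ 2) set \<Rightarrow> (real ^ 2) measure set" where
  "borel_prob_measures_on K = {\<mu>. prob_space \<mu> \<and> sets \<mu> = sets (restrict_space borel K)}"

text \<open>For nonempty compact \<open>K\<close> the infimum is attained, so it is the minimum over \<open>\<mu>\<close>;
  for \<open>K = {}\<close> there is no \<open>\<mu>\<close>, and the value is \<open>\<infinity>\<close>.\<close>

definition log_energy :: "(real ^ 2) set \<Rightarrow> ereal" where
  "log_energy K =
     (INF \<mu> \<in> borel_prob_measures_on K. ereal_integral \<mu> (\<lambda>x. ereal_integral \<mu> (\<lambda>y. log_kernel x y)))"

text \<open>The value \<open>-\<infinity>\<close> of the energy does not occur for compact \<open>K\<close>.\<close>

definition log_capacity :: "(real ^ 2) set \<Rightarrow> real" where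
  "log_capacity K = (if log_energy K = \<infinity> then 0 else exp (- real_of_ereal (log_energy K)))"

definition plane_rotation :: "real \<Rightarrow> real ^ 2 ^ 2" where
  "plane_rotation \<theta> = vector [vector [cos \<theta>, - sin \<theta>], vector [sin \<theta>, cos \<theta>]]"

definition rotational_symmetry :: "nat \<Rightarrow> (real ^ 2) set \<Rightarrow> bool" where
  "rotational_symmetry N K \<longleftrightarrow> (*v) (plane_rotation (2 * pi / real N)) ` K = K"

end

theory Submission
  imports Defs "HOL-Computational_Algebra.Fundamental_Theorem_Algebra"
begin

text \<open>
  Push a measure \<open>\<mu>\<close> on \<open>K\<close> forward to \<open>M K\<close> by \<open>M R\<^sup>j\<close> for several rotations \<open>R\<^sup>j\<close> of the symmetry group.
  Each energy is that of \<open>\<mu>\<close> minus the mean of \<open>ln (|M R\<^sup>j w| / |w|)\<close> over \<open>w = x - y\<close>. Writing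
  \<open>M z = a z + b cnj z\<close>, so that \<open>|a|\<^sup>2 - |b|\<^sup>2 = det M\<close>, the product of the \<open>|M R\<^sup>j w| / |w|\<close> over suitable
  \<open>m\<close> rotations factors through the \<open>m\<close>-th roots of unity and is at least \<open>||a|\<^sup>m - |b|\<^sup>m| \<ge> 1\<close>. Hence one
  of the test measures does not have larger energy, and for \<open>m \<ge> 3\<close> and \<open>M\<close> not orthogonal there is
  a gain independent of \<open>\<mu>\<close>; neither an equilibrium measure nor its uniqueness is needed.

  For \<open>m = 2\<close> (that is, \<open>N = 4\<close>) there is no gain along the two singular directions of \<open>M\<close>. If both
  \<open>M\<close> and \<open>M R\<close> gave almost nothing, nearly all differences \<open>x - y\<close> would be close to one of these
  axes, with a definite proportion for each. A triangle with one side along each axis and the third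
  near an axis has a very short side, which bounded energy makes improbable; so the axis would be
  the same for all pairs with a common point, hence for independent pairs, a contradiction.
\<close>

section \<open>Linear maps of the plane in complex coordinates\<close>

definition cplx :: "real ^ 2 \<Rightarrow> complex" where
  "cplx w = Complex (w $ 1) (w $ 2)"

definition lin_part :: "real ^ 2 ^ 2 \<Rightarrow> complex" where
  "lin_part M = Complex ((M $ 1 $ 1 + M $ 2 $ 2) / 2) ((M $ 2 $ 1 - M $ 1 $ 2) / 2)"

definition antilin_part :: "real ^ 2 ^ 2 \<Rightarrow> complex" where
  "antilin_part M = Complex ((M $ 1 $ 1 - M $ 2 $ 2) / 2) ((M $ 2 $ 1 + M $ 1 $ 2) / 2)"

text \<open>The value at \<open>w = 0\<close> is \<open>ln (0 / 0) = ln 0 = 0\<close>.\<close>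

definition log_gain :: "real ^ 2 ^ 2 \<Rightarrow> real ^ 2 \<Rightarrow> real" where
  "log_gain T w = ln (norm (T *v w) / norm w)"

lemma norm_cplx: "cmod (cplx w) = norm w"
  by (simp add: cplx_def cmod_def norm_vec_def L2_set_def sum_2)

lemma cplx_inject: "cplx v = cplx w \<longleftrightarrow> v = w"
  by (auto simp: cplx_def vec_eq_iff forall_2)

lemma cplx_matvec:
  "cplx (M *v w) = lin_part M * cplx w + antilin_part M * cnj (cplx w)"
  by (simp add: cplx_def lin_part_def antilin_part_def matrix_vector_mult_def sum_2
      complex_eq_iff field_simps)

lemma cmod_parts_det: "(cmod (lin_part M))\<^sup>2 - (cmod (antilin_part M))\<^sup>2 = det M"
  unfolding cmod_power2 by (simp add: lin_part_def antilin_part_def det_2 field_simps power2_eq_square)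

lemma cplx_plane_rotation: "cplx (plane_rotation t *v w) = cis t * cplx w"
  by (simp add: cplx_def plane_rotation_def matrix_vector_mult_def sum_2 complex_eq_iff)

lemma det_plane_rotation [simp]: "det (plane_rotation t) = 1"
proof -
  have "det (plane_rotation t) = (sin t)\<^sup>2 + (cos t)\<^sup>2"
    by (simp add: plane_rotation_def det_2 power2_eq_square algebra_simps del: sin_cos_squared_add)
  then show ?thesis by simp
qed

lemma plane_rotation_add:
  "plane_rotation s *v (plane_rotation t *v w) = plane_rotation (s + t) *v w"
  by (simp add: cplx_plane_rotation cis_mult flip: cplx_inject mult.assoc)

lemma norm_matvec_plane_rotation:
  "norm ((M ** plane_rotation t) *v w) =
     cmod (lin_part M * cis t * cplx w + antilin_part M * cis (- t) * cnj (cplx w))"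
  unfolding norm_cplx[symmetric] matrix_vector_mul_assoc[symmetric] cplx_matvec[of M] cplx_plane_rotation
  by (simp add: cis_cnj mult.assoc)

text \<open>If one part vanishes, \<open>M\<close> is multiplication by a complex number, possibly
  composed with conjugation, and the determinant forces that number to have modulus 1.\<close>

lemma orthogonal_matrix_if_part_eq_0:
  assumes "\<bar>det M\<bar> = 1" and "lin_part M = 0 \<or> antilin_part M = 0"
  shows "orthogonal_matrix M"
proof -
  have "norm (M *v w) = norm w" for w
  proof (cases "lin_part M = 0")
    case True
    then have "(cmod (antilin_part M))\<^sup>2 = - det M"
      using cmod_parts_det[of M] by simp
    then have "(cmod (antilin_part M))\<^sup>2 = 1"
      using assms(1) zero_le_power2[of "cmod (antilin_part M)"] by linarith
    then have "cmod (antilin_part M) = 1"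
      using power2_eq_1_iff[of "cmod (antilin_part M)"] norm_ge_zero[of "antilin_part M"] by linarith
    then show ?thesis
      using True by (simp add: cplx_matvec norm_mult flip: norm_cplx)
  next
    case False
    with assms(2) have 0: "antilin_part M = 0" by simp
    then have "(cmod (lin_part M))\<^sup>2 = 1"
      using cmod_parts_det[of M] assms(1) zero_le_power2[of "cmod (lin_part M)"] by auto
    then have "cmod (lin_part M) = 1"
      using power2_eq_1_iff[of "cmod (lin_part M)"] norm_ge_zero[of "lin_part M"] by linarith
    then show ?thesis
      using 0 by (simp add: cplx_matvec norm_mult flip: norm_cplx)
  qed
  then have "orthogonal_transformation ((*v) M)"
    by (simp add: orthogonal_transformation)
  then show ?thesis
    by (simp add: orthogonal_transformation_matrix)
qed

text \<open>For nonzero \<open>b\<close> this is the factorization of \<open>X ^ m - 1\<close> over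
  its roots, evaluated at \<open>a / b\<close> and multiplied by \<open>b ^ m\<close>.\<close>

lemma prod_diff_roots_of_unity:
  fixes a b :: complex
  assumes "m > 0"
  shows "(\<Prod>j<m. a - cis (2 * pi * real j / real m) * b) = a ^ m - b ^ m"
proof (cases "b = 0")
  case True
  then show ?thesis using assms by simp
next
  case False
  define p :: "complex poly" where "p = monom 1 m - 1"
  have ev: "poly p z = z ^ m - 1" for z
    by (simp add: p_def poly_monom)
  have deg: "degree p = m" and lc: "lead_coeff p = 1"
  proof -
    have "degree (monom 1 m - 1 :: complex poly) = degree (monom 1 m :: complex poly)"
      unfolding diff_conv_add_uminus using assms
      by (intro degree_add_eq_left) (auto simp: degree_monom_eq)
    then show "degree p = m" by (simp add: p_def degree_monom_eq)
    then show "lead_coeff p = 1"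
      using assms by (simp add: p_def)
  qed
  \<comment> \<open>The derivative of \<open>p\<close> can vanish only at 0, which is not a root of
    \<open>p\<close>; so all roots are simple.\<close>
  have "rsquarefree p"
    unfolding rsquarefree_roots
  proof (intro allI notI, elim conjE)
    fix z assume "poly p z = 0" "poly (pderiv p) z = 0"
    moreover have "poly (pderiv p) z = of_nat m * z ^ (m - 1)"
      by (simp add: p_def pderiv_diff pderiv_monom poly_monom)
    ultimately show False
      using assms by (auto simp: ev power_0_left)
  qed
  then have "(\<Prod>z | poly p z = 0. [:- z, 1:]) = p"
    using complex_poly_decompose_rsquarefree[of p] lc by simp
  then have "poly (\<Prod>z | z ^ m = 1. [:- z, 1:]) (a / b) = (a / b) ^ m - 1"
    using ev by simp
  then have "(\<Prod>z | z ^ m = 1. a / b - z) = (a / b) ^ m - 1"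
    by (simp add: poly_prod)
  moreover have "(\<Prod>z | z ^ m = 1. a / b - z) = (\<Prod>j<m. a / b - cis (2 * pi * real j / real m))"
    using prod.reindex_bij_betw[OF Complex.bij_betw_roots_unity[OF assms], of "\<lambda>z. a / b - z"] by simp
  ultimately have "(\<Prod>j<m. b * (a / b - cis (2 * pi * real j / real m))) = b ^ m * ((a / b) ^ m - 1)"
    by (simp add: prod.distrib)
  moreover have "b * (a / b - c) = a - c * b" for c
    using False by (simp add: field_simps)
  moreover have "b ^ m * ((a / b) ^ m - 1) = a ^ m - b ^ m"
    using False by (simp add: field_simps)
  ultimately show ?thesis by simp
qed

text \<open>Multiplying the \<open>j\<close>-th image by the unit number
  \<open>cis (j * \<psi>)\<close> keeps its modulus and collects the rotation in a factor
  \<open>cis (2 * j * \<psi>)\<close> before the linear part. These factors run through the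
  \<open>m\<close>-th roots of unity, so the product collapses to a difference of powers.\<close>

lemma prod_norm_rotated_images:
  assumes "m > 0" and "cis (2 * \<psi>) = cis (2 * pi / real m)"
  shows "(\<Prod>j<m. norm ((M ** plane_rotation (real j * \<psi>)) *v w)) =
    cmod ((antilin_part M * cnj (cplx w)) ^ m - (- lin_part M * cplx w) ^ m)"
proof -
  let ?a = "lin_part M" and ?b = "antilin_part M"
  have "norm ((M ** plane_rotation (real j * \<psi>)) *v w) =
      cmod (?b * cnj (cplx w) - cis (2 * pi * real j / real m) * (- ?a * cplx w))" for j
  proof -
    have "cis (real j * \<psi>) * cis (real j * \<psi>) = cis (2 * \<psi>) ^ j"
      unfolding cis_mult Complex.DeMoivre by (simp only: mult_2 distrib_left)
    also have "\<dots> = cis (2 * pi * real j / real m)"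
      unfolding assms(2) Complex.DeMoivre by (simp add: mult.commute)
    finally have sq: "cis (2 * pi * real j / real m) = cis (real j * \<psi>) * cis (real j * \<psi>)" ..
    have inv: "cis (- (real j * \<psi>)) * cis (real j * \<psi>) = 1"
      by (simp add: cis_mult)
    have "?b * cnj (cplx w) - cis (2 * pi * real j / real m) * (- ?a * cplx w)
        = cis (real j * \<psi>) * (?a * cis (real j * \<psi>) * cplx w)
          + ?b * cnj (cplx w) * (cis (- (real j * \<psi>)) * cis (real j * \<psi>))"
      unfolding sq inv by (simp add: mult_ac)
    also have "\<dots> = cis (real j * \<psi>) *
        (?a * cis (real j * \<psi>) * cplx w + ?b * cis (- (real j * \<psi>)) * cnj (cplx w))"
      by (simp only: distrib_left mult_ac)
    finally show ?thesis
      by (simp only: norm_matvec_plane_rotation norm_mult norm_cis mult_1_left)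
  qed
  then show ?thesis
    unfolding prod_diff_roots_of_unity[OF assms(1), symmetric] prod_norm[symmetric] by simp
qed

text \<open>Substituting \<open>x^2 = 1 + y^2\<close> once turns \<open>x^m\<close> into
  \<open>x^(m-2) + x^(m-2) * y^2\<close>. Since \<open>x\<close> is at least \<open>1\<close> and at
  least \<open>y\<close>, the difference is at least \<open>x^(m-2)\<close>, which exceeds 1 when
  \<open>m \<ge> 3\<close> and \<open>y > 0\<close>.\<close>

lemma power_diff_ge_1:
  fixes x y :: real
  assumes "x\<^sup>2 - y\<^sup>2 = 1" "0 \<le> x" "0 \<le> y" "m \<ge> 2"
  shows "x ^ m - y ^ m \<ge> 1" and "m \<ge> 3 \<Longrightarrow> y > 0 \<Longrightarrow> x ^ m - y ^ m > 1"
proof -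
  obtain k where k: "m = k + 2"
    using le_Suc_ex[OF assms(4)] by (auto simp: add.commute)
  have x2: "x\<^sup>2 = 1 + y\<^sup>2" using assms(1) by simp
  have x1: "x \<ge> 1"
    using assms(2) x2 by (intro power2_le_imp_le[of 1 x]) auto
  have xy: "x \<ge> y"
    using assms(2) x2 by (intro power2_le_imp_le[of y x]) auto
  have 1: "x ^ k * y\<^sup>2 \<ge> y ^ k * y\<^sup>2"
    using xy assms by (intro mult_right_mono power_mono) auto
  have eq: "x ^ m = x ^ k + x ^ k * y\<^sup>2"
    unfolding k power_add x2 by (simp only: distrib_left mult_1_right)
  have eqy: "y ^ m = y ^ k * y\<^sup>2"
    unfolding k power_add ..
  show "x ^ m - y ^ m \<ge> 1"
    using 1 eq eqy one_le_power[OF x1, of k] by linarith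
  assume m3: "m \<ge> 3" and y: "y > 0"
  have "x\<^sup>2 > 1" using x2 y by simp
  then have "x > 1" using x1 by (cases "x = 1") auto
  then have "x ^ k > 1" using m3 k by simp
  then show "x ^ m - y ^ m > 1"
    using 1 eq eqy by linarith
qed

text \<open>Here \<open>s\<close> is the larger singular value of \<open>T\<close>. The smaller one
  is the distance between the two moduli, and it equals \<open>1 / s\<close> because the product of
  both is the absolute value of \<open>det T\<close>.\<close>

lemma norm_matvec_bounds:
  fixes T :: "real ^ 2 ^ 2"
  assumes "\<bar>det T\<bar> = 1"
  defines "s \<equiv> cmod (lin_part T) + cmod (antilin_part T)"
  shows "s \<ge> 1" and "norm (T *v w) \<le> s * norm w" and "norm w / s \<le> norm (T *v w)"
proof -
  let ?a = "cmod (lin_part T)" and ?b = "cmod (antilin_part T)"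
  have "\<bar>?a\<^sup>2 - ?b\<^sup>2\<bar> = 1" using cmod_parts_det[of T] assms(1) by simp
  moreover have "?a\<^sup>2 - ?b\<^sup>2 = s * (?a - ?b)"
    by (simp add: s_def power2_eq_square algebra_simps)
  ultimately have p: "s * \<bar>?a - ?b\<bar> = 1"
    by (simp add: abs_mult s_def)
  have "\<bar>?a - ?b\<bar> \<le> s" using norm_ge_zero[of "lin_part T"] norm_ge_zero[of "antilin_part T"]
    unfolding s_def by linarith
  moreover have s0: "s > 0" using p by (cases "s = 0") (auto simp: s_def less_le)
  ultimately have "1 \<le> s * s" using p mult_left_mono[of "\<bar>?a - ?b\<bar>" s s] by simp
  then have "1\<^sup>2 \<le> s\<^sup>2" by (simp add: power2_eq_square)
  then show "s \<ge> 1" using s0 power2_le_imp_le[of 1 s] by simp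
  show "norm (T *v w) \<le> s * norm w"
    using norm_triangle_ineq[of "lin_part T * cplx w" "antilin_part T * cnj (cplx w)"]
    by (simp add: cplx_matvec norm_mult s_def algebra_simps flip: norm_cplx)
  have "\<bar>?a - ?b\<bar> * norm w = \<bar>(?a - ?b) * norm w\<bar>"
    by (simp add: abs_mult)
  also have "\<dots> \<le> norm (T *v w)"
    using norm_triangle_ineq3[of "lin_part T * cplx w" "- antilin_part T * cnj (cplx w)"]
    unfolding norm_cplx[of "T *v w", symmetric] cplx_matvec norm_mult norm_minus_cancel
      complex_mod_cnj norm_cplx left_diff_distrib
    by simp
  finally have "\<bar>?a - ?b\<bar> * norm w \<le> norm (T *v w)" .
  moreover have "\<bar>?a - ?b\<bar> = 1 / s" using p s0 by (simp add: field_simps)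
  ultimately show "norm w / s \<le> norm (T *v w)" by simp
qed

lemma norm_matvec_pos:
  fixes T :: "real ^ 2 ^ 2"
  assumes "\<bar>det T\<bar> = 1" and "w \<noteq> 0"
  shows "norm (T *v w) > 0"
proof -
  have "0 < norm w / (cmod (lin_part T) + cmod (antilin_part T))"
    using norm_matvec_bounds(1)[OF assms(1)] assms(2) by (intro divide_pos_pos) auto
  then show ?thesis
    using norm_matvec_bounds(3)[OF assms(1), of w] by linarith
qed

text \<open>This uniform bound makes the gain integrable with respect to every probability
  measure.\<close>

lemma abs_log_gain_le:
  fixes T :: "real ^ 2 ^ 2"
  assumes "\<bar>det T\<bar> = 1"
  shows "\<bar>log_gain T w\<bar> \<le> ln (cmod (lin_part T) + cmod (antilin_part T))"
proof (cases "w = 0")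
  case True
  then show ?thesis using norm_matvec_bounds(1)[OF assms] by (simp add: log_gain_def)
next
  case False
  define s where "s = cmod (lin_part T) + cmod (antilin_part T)"
  note b = norm_matvec_bounds[OF assms, folded s_def]
  let ?q = "norm (T *v w) / norm w"
  have q0: "?q > 0" using norm_matvec_pos[OF assms False] False by simp
  have "?q \<le> s" "1 / s \<le> ?q"
    using b(2,3)[of w] False b(1) by (auto simp: field_simps)
  then have "ln ?q \<le> ln s" "ln (1 / s) \<le> ln ?q"
    using q0 b(1) by (auto intro!: ln_mono)
  then show ?thesis
    using b(1) unfolding log_gain_def s_def[symmetric] by (simp add: ln_div)
qed

text \<open>The constant is \<open>ln d\<close>, where \<open>d\<close> comes from the product
  formula by the reverse triangle inequality. The sign of \<open>det M\<close> decides which of the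
  two moduli is larger. For \<open>m = 2\<close> the value \<open>d\<close> is the absolute
  determinant 1, so a positive constant is claimed only from \<open>m = 3\<close> on.\<close>

lemma sum_log_gain_ge:
  assumes "\<bar>det M\<bar> = 1" and m: "m \<ge> 2" and \<psi>: "cis (2 * \<psi>) = cis (2 * pi / real m)"
  obtains c where "c \<ge> 0" and "m \<ge> 3 \<Longrightarrow> \<not> orthogonal_matrix M \<Longrightarrow> c > 0"
    and "\<And>w. w \<noteq> 0 \<Longrightarrow> (\<Sum>j<m. log_gain (M ** plane_rotation (real j * \<psi>)) w) \<ge> c"
proof -
  let ?a = "cmod (lin_part M)" and ?b = "cmod (antilin_part M)"
  define d where "d = \<bar>?b ^ m - ?a ^ m\<bar>"
  have det: "\<bar>?a\<^sup>2 - ?b\<^sup>2\<bar> = 1"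
    using cmod_parts_det[of M] assms(1) by simp
  then have "d \<ge> 1 \<and> (m \<ge> 3 \<longrightarrow> ?a > 0 \<longrightarrow> ?b > 0 \<longrightarrow> d > 1)"
  proof (cases "?a\<^sup>2 - ?b\<^sup>2 = 1")
    case True
    show ?thesis
      using power_diff_ge_1[OF True norm_ge_zero norm_ge_zero m] unfolding d_def by linarith
  next
    case False
    with det have "?b\<^sup>2 - ?a\<^sup>2 = 1" by linarith
    from power_diff_ge_1[OF this norm_ge_zero norm_ge_zero m] show ?thesis
      unfolding d_def by linarith
  qed
  then have d: "d \<ge> 1" "m \<ge> 3 \<Longrightarrow> ?a > 0 \<Longrightarrow> ?b > 0 \<Longrightarrow> d > 1"
    by auto
  have "(\<Sum>j<m. log_gain (M ** plane_rotation (real j * \<psi>)) w) \<ge> ln d" if w: "w \<noteq> 0" for w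
  proof -
    let ?T = "\<lambda>j. M ** plane_rotation (real j * \<psi>)"
    have pos: "0 < norm (?T j *v w) / norm w" for j
      using norm_matvec_pos[of "?T j" w] w assms(1) by (simp add: det_mul)
    have "d * norm w ^ m = \<bar>cmod ((antilin_part M * cnj (cplx w)) ^ m) -
        cmod ((- lin_part M * cplx w) ^ m)\<bar>"
      by (simp add: d_def norm_power norm_mult power_mult_distrib norm_cplx abs_mult
          flip: left_diff_distrib)
    also have "\<dots> \<le> (\<Prod>j<m. norm (?T j *v w))"
      using m by (subst prod_norm_rotated_images[OF _ \<psi>]) (auto intro: norm_triangle_ineq3)
    finally have "d \<le> (\<Prod>j<m. norm (?T j *v w) / norm w)"
      using w by (simp add: prod_dividef field_simps)
    then have "ln d \<le> ln (\<Prod>j<m. norm (?T j *v w) / norm w)"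
      using d(1) by (intro ln_mono) auto
    also have "\<dots> = (\<Sum>j<m. log_gain (?T j) w)"
      unfolding log_gain_def
    proof (rule ln_prod)
      show "norm (?T j *v w) / norm w \<noteq> 0" for j
        using pos[of j] by linarith
    qed simp
    finally show ?thesis .
  qed
  moreover have "ln d > 0" if "m \<ge> 3" "\<not> orthogonal_matrix M"
    using d(2) that orthogonal_matrix_if_part_eq_0[OF assms(1)] by (intro ln_gt_zero) auto
  ultimately show thesis
    using that[of "ln d"] d(1) by auto
qed

section \<open>Energies of measures and of their linear images\<close>

text \<open>Shifting a kernel that is bounded below makes it nonnegative, which removes the difference of
  the positive and negative parts.\<close>

lemma ereal_integral_shift:
  assumes "prob_space \<mu>" and [measurable]: "f \<in> borel_measurable \<mu>" and C: "C \<ge> 0"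
    and f: "\<And>x. x \<in> space \<mu> \<Longrightarrow> f x \<ge> - ereal C"
  shows "ereal_integral \<mu> f = enn2ereal (\<integral>\<^sup>+ x. e2ennreal (f x + ereal C) \<partial>\<mu>) - ereal C"
proof -
  interpret prob_space \<mu> by fact
  define a b s where "a = (\<integral>\<^sup>+ x. e2ennreal (f x) \<partial>\<mu>)" and "b = (\<integral>\<^sup>+ x. e2ennreal (- f x) \<partial>\<mu>)"
    and "s = (\<integral>\<^sup>+ x. e2ennreal (f x + ereal C) \<partial>\<mu>)"
  have pw: "e2ennreal (f x) + ennreal C = e2ennreal (f x + ereal C) + e2ennreal (- f x)"
      "e2ennreal (- f x) \<le> ennreal C" if "x \<in> space \<mu>" for x
    using f[OF that] C
    by (cases "f x"; cases "f x \<ge> 0";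
        simp add: e2ennreal_ereal ennreal_neg ennreal_leI e2ennreal_neg flip: ennreal_plus)+
  have "a + ennreal C = (\<integral>\<^sup>+ x. e2ennreal (f x) + ennreal C \<partial>\<mu>)"
    by (simp add: a_def nn_integral_add emeasure_space_1)
  also have "\<dots> = (\<integral>\<^sup>+ x. e2ennreal (f x + ereal C) + e2ennreal (- f x) \<partial>\<mu>)"
    by (intro nn_integral_cong pw)
  also have "\<dots> = s + b"
    by (simp add: s_def b_def nn_integral_add)
  finally have eq: "enn2ereal a + ereal C = enn2ereal s + enn2ereal b"
    using C by (metis enn2ereal_ennreal plus_ennreal.rep_eq)
  have "b \<le> (\<integral>\<^sup>+ x. ennreal C \<partial>\<mu>)"
    unfolding b_def by (intro nn_integral_mono pw)
  then have "b \<le> ennreal C" by (simp add: emeasure_space_1)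
  then obtain r where "b = ennreal r" "r \<ge> 0"
    by (metis ennreal_cases ennreal_neq_top neq_top_trans)
  then have "enn2ereal a - enn2ereal b = enn2ereal s - ereal C"
    using eq by (cases "enn2ereal a"; cases "enn2ereal s") auto
  then show ?thesis by (simp add: ereal_integral_def a_def b_def s_def)
qed

definition energy_of :: "(real ^ 2) measure \<Rightarrow> ereal" where
  "energy_of \<mu> = ereal_integral \<mu> (\<lambda>x. ereal_integral \<mu> (\<lambda>y. log_kernel x y))"

lemma log_energy_eq: "log_energy K = (INF \<mu> \<in> borel_prob_measures_on K. energy_of \<mu>)"
  by (simp add: log_energy_def energy_of_def)

lemma log_kernel_measurable [measurable]:
  assumes [measurable]: "f \<in> borel_measurable M" "g \<in> borel_measurable M"
  shows "(\<lambda>p. log_kernel (f p) (g p)) \<in> borel_measurable M"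
proof -
  have "(\<lambda>p. log_kernel (f p) (g p)) =
      (\<lambda>p. if norm (f p - g p) = 0 then \<infinity> else ereal (ln (1 / norm (f p - g p))))"
    by (auto simp: log_kernel_def)
  also have "\<dots> \<in> borel_measurable M" by measurable
  finally show ?thesis .
qed

lemma borel_prob_measures_onD:
  assumes "\<mu> \<in> borel_prob_measures_on K"
  shows "prob_space \<mu>" and "space \<mu> = K" and "(\<lambda>x. x) \<in> borel_measurable \<mu>"
proof -
  have *: "sets \<mu> = sets (restrict_space borel K)"
    using assms by (simp add: borel_prob_measures_on_def)
  show "prob_space \<mu>" using assms by (simp add: borel_prob_measures_on_def)
  show "space \<mu> = K" using sets_eq_imp_space_eq[OF *] by (simp add: space_restrict_space)
  show "(\<lambda>x. x) \<in> borel_measurable \<mu>"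
    unfolding measurable_cong_sets[OF * refl] by (rule measurable_restrict_space1) simp
qed

lemma log_kernel_ge:
  assumes "D \<ge> 1" and "norm (x - y) \<le> D"
  shows "log_kernel x y \<ge> - ereal (ln D)"
  using assms by (auto simp: log_kernel_def ln_div)

text \<open>The shift by \<open>ln D\<close> is applied to the inner and then to the outer integral,
  where it cancels the \<open>- ln D\<close> left by the first. What remains is one iterated
  integral of a nonnegative function, to which Tonelli applies.\<close>

lemma energy_of_shift:
  assumes \<mu>: "\<mu> \<in> borel_prob_measures_on K" and D: "D \<ge> 1"
    and K: "\<forall>x\<in>K. \<forall>y\<in>K. norm (x - y) \<le> D"
  shows "energy_of \<mu> =
    enn2ereal (\<integral>\<^sup>+ x. \<integral>\<^sup>+ y. e2ennreal (log_kernel x y + ereal (ln D)) \<partial>\<mu> \<partial>\<mu>) - ereal (ln D)"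
proof -
  note [measurable] = borel_prob_measures_onD(3)[OF \<mu>]
  interpret prob_space \<mu> by (rule borel_prob_measures_onD(1)[OF \<mu>])
  note sp = borel_prob_measures_onD(2)[OF \<mu>]
  have D0: "ln D \<ge> 0" using D by simp
  have inner: "ereal_integral \<mu> (\<lambda>y. log_kernel x y) =
      enn2ereal (\<integral>\<^sup>+ y. e2ennreal (log_kernel x y + ereal (ln D)) \<partial>\<mu>) - ereal (ln D)"
    if "x \<in> space \<mu>" for x
    using that K log_kernel_ge[OF D] sp by (intro ereal_integral_shift D0 prob_space_axioms) auto
  define \<Phi> where "\<Phi> x = (\<integral>\<^sup>+ y. e2ennreal (log_kernel x y + ereal (ln D)) \<partial>\<mu>)" for x
  have [measurable]: "\<Phi> \<in> borel_measurable \<mu>"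
    unfolding \<Phi>_def by measurable
  have "energy_of \<mu> = ereal_integral \<mu> (\<lambda>x. enn2ereal (\<Phi> x) - ereal (ln D))"
    unfolding energy_of_def ereal_integral_def[of \<mu> "\<lambda>x. ereal_integral \<mu> (log_kernel x)"]
      ereal_integral_def[of \<mu> "\<lambda>x. enn2ereal (\<Phi> x) - ereal (ln D)"]
    using inner by (simp add: \<Phi>_def cong: nn_integral_cong)
  also have "\<dots> = enn2ereal (\<integral>\<^sup>+ x. e2ennreal (enn2ereal (\<Phi> x) - ereal (ln D) + ereal (ln D)) \<partial>\<mu>) - ereal (ln D)"
  proof (rule ereal_integral_shift)
    show "- ereal (ln D) \<le> enn2ereal (\<Phi> x) - ereal (ln D)" for x
      using enn2ereal_nonneg[of "\<Phi> x"] by (cases "enn2ereal (\<Phi> x)") auto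
  qed (use D0 prob_space_axioms in auto)
  also have "(\<lambda>x. enn2ereal (\<Phi> x) - ereal (ln D) + ereal (ln D)) = (\<lambda>x. enn2ereal (\<Phi> x))"
  proof
    show "enn2ereal (\<Phi> x) - ereal (ln D) + ereal (ln D) = enn2ereal (\<Phi> x)" for x
      by (cases "enn2ereal (\<Phi> x)") auto
  qed
  finally show ?thesis by (simp add: \<Phi>_def)
qed

lemma energy_of_ge:
  assumes \<mu>: "\<mu> \<in> borel_prob_measures_on K" and D: "D \<ge> 1"
    and K: "\<forall>x\<in>K. \<forall>y\<in>K. norm (x - y) \<le> D"
  shows "energy_of \<mu> \<ge> - ereal (ln D)"
proof -
  define I where "I = (\<integral>\<^sup>+ x. \<integral>\<^sup>+ y. e2ennreal (log_kernel x y + ereal (ln D)) \<partial>\<mu> \<partial>\<mu>)"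
  have "energy_of \<mu> = enn2ereal I - ereal (ln D)"
    unfolding I_def by (rule energy_of_shift[OF assms])
  then show ?thesis
    using enn2ereal_nonneg[of I] by (cases "enn2ereal I") auto
qed

section \<open>Finite energies as real integrals over pairs, and push-forwards\<close>

lemma measurable_matvec [measurable]: "(*v) (T :: real ^ 2 ^ 2) \<in> borel_measurable borel"
  by (intro borel_measurable_continuous_onI linear_continuous_on matrix_vector_mul_bounded_linear)

lemma measurable_log_gain [measurable]: "log_gain T \<in> borel_measurable borel"
  unfolding log_gain_def by measurable

lemma borel_measurable_fst_snd:
  assumes "(\<lambda>x. x) \<in> borel_measurable \<mu>"
  shows "fst \<in> borel_measurable (\<mu> \<Otimes>\<^sub>M \<mu>)" and "snd \<in> borel_measurable (\<mu> \<Otimes>\<^sub>M \<mu>)"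
  by (rule measurable_compose[OF measurable_fst assms] measurable_compose[OF measurable_snd assms])+

text \<open>Finite energy makes the shifted kernel finite almost everywhere, and the kernel is
  infinite on the diagonal, so the diagonal is a null set. Off it the shifted kernel is a
  nonnegative real function, and extended-real arithmetic can be left for Bochner integrals on the
  product.\<close>

lemma finite_energyD:
  assumes \<mu>: "\<mu> \<in> borel_prob_measures_on K" and D: "D \<ge> 1"
    and K: "\<forall>x\<in>K. \<forall>y\<in>K. norm (x - y) \<le> D"
    and fin: "energy_of \<mu> < \<infinity>"
  shows "AE p in \<mu> \<Otimes>\<^sub>M \<mu>. fst p \<noteq> snd p"
    and "integrable (\<mu> \<Otimes>\<^sub>M \<mu>) (\<lambda>p. ln (norm (fst p - snd p)))"
    and "energy_of \<mu> = ereal (- (\<integral>p. ln (norm (fst p - snd p)) \<partial>(\<mu> \<Otimes>\<^sub>M \<mu>)))"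
proof -
  note id[measurable] = borel_prob_measures_onD(3)[OF \<mu>]
  interpret prob_space \<mu> by (rule borel_prob_measures_onD(1)[OF \<mu>])
  interpret P: pair_prob_space \<mu> \<mu> ..
  note sp = borel_prob_measures_onD(2)[OF \<mu>]
  note [measurable] = borel_measurable_fst_snd[OF id]
  let ?P = "\<mu> \<Otimes>\<^sub>M \<mu>"
  define k where "k p = e2ennreal (log_kernel (fst p) (snd p) + ereal (ln D))" for p
  have [measurable]: "k \<in> borel_measurable ?P"
    unfolding k_def by measurable
  have kint: "(\<integral>\<^sup>+ p. k p \<partial>?P) = (\<integral>\<^sup>+ x. \<integral>\<^sup>+ y. e2ennreal (log_kernel x y + ereal (ln D)) \<partial>\<mu> \<partial>\<mu>)"
    by (subst nn_integral_fst[symmetric]) (auto simp: k_def)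
  have en: "energy_of \<mu> = enn2ereal (\<integral>\<^sup>+ p. k p \<partial>?P) - ereal (ln D)"
    unfolding kint by (rule energy_of_shift[OF \<mu> D K])
  have kfin: "(\<integral>\<^sup>+ p. k p \<partial>?P) \<noteq> \<infinity>"
    using fin unfolding en by auto
  have "AE p in ?P. k p \<noteq> \<infinity>"
    by (rule nn_integral_PInf_AE[OF _ kfin]) measurable
  then show ne: "AE p in ?P. fst p \<noteq> snd p"
    by (rule AE_mp) (auto simp: k_def log_kernel_def)
  define g where "g p = ln D - ln (norm (fst p - snd p))" for p :: "(real ^ 2) \<times> (real ^ 2)"
  have [measurable]: "g \<in> borel_measurable ?P"
    unfolding g_def by measurable
  have kg: "AE p in ?P. k p = ennreal (g p)"
    using ne
  proof (rule AE_mp, intro AE_I2 impI)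
    fix p :: "(real ^ 2) \<times> (real ^ 2)" assume "fst p \<noteq> snd p"
    then show "k p = ennreal (g p)"
      by (simp add: k_def g_def log_kernel_def ln_div e2ennreal_ereal)
  qed
  have g0: "AE p in ?P. 0 \<le> g p"
    using ne
  proof (rule AE_mp, intro AE_I2 impI)
    fix p :: "(real ^ 2) \<times> (real ^ 2)" assume "p \<in> space ?P" "fst p \<noteq> snd p"
    then show "0 \<le> g p"
      using K by (auto simp: g_def space_pair_measure sp intro!: ln_mono)
  qed
  have gfin: "(\<integral>\<^sup>+ p. ennreal (g p) \<partial>?P) < \<infinity>"
    using kfin nn_integral_cong_AE[OF kg] by (simp add: less_top)
  have gi: "integrable ?P g"
    by (rule integrableI_nonneg[OF _ g0 gfin]) measurable
  have "integrable ?P (\<lambda>p. ln D - g p)"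
    using gi by (intro Bochner_Integration.integrable_diff) auto
  then show li: "integrable ?P (\<lambda>p. ln (norm (fst p - snd p)))"
    by (simp add: g_def)
  have "(\<integral>\<^sup>+ p. k p \<partial>?P) = ennreal (integral\<^sup>L ?P g)"
    unfolding nn_integral_cong_AE[OF kg] by (rule nn_integral_eq_integral[OF gi g0])
  moreover have "integral\<^sup>L ?P g \<ge> 0" by (rule integral_nonneg_AE[OF g0])
  moreover have "integral\<^sup>L ?P g = ln D - (\<integral>p. ln (norm (fst p - snd p)) \<partial>?P)"
    unfolding g_def using li by (subst Bochner_Integration.integral_diff) (auto simp: P.prob_space)
  ultimately show "energy_of \<mu> = ereal (- (\<integral>p. ln (norm (fst p - snd p)) \<partial>?P))"
    unfolding en by simp
qed

lemma bounded_diameter: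
  fixes K :: "(real ^ 2) set"
  assumes "bounded K"
  obtains D where "D \<ge> 1" "\<forall>x\<in>K. \<forall>y\<in>K. norm (x - y) \<le> D"
proof
  show "max 1 (diameter K) \<ge> 1" by simp
  show "\<forall>x\<in>K. \<forall>y\<in>K. norm (x - y) \<le> max 1 (diameter K)"
    using diameter_bounded_bound[OF assms] by (simp add: dist_norm max.coboundedI2)
qed

lemma integrable_log_gain:
  fixes T :: "real ^ 2 ^ 2"
  assumes \<mu>: "\<mu> \<in> borel_prob_measures_on K" and "\<bar>det T\<bar> = 1"
  shows "integrable (\<mu> \<Otimes>\<^sub>M \<mu>) (\<lambda>p. log_gain T (fst p - snd p))"
proof -
  note id[measurable] = borel_prob_measures_onD(3)[OF \<mu>]
  interpret prob_space \<mu> by (rule borel_prob_measures_onD(1)[OF \<mu>])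
  interpret P: pair_prob_space \<mu> \<mu> ..
  note [measurable] = borel_measurable_fst_snd[OF id]
  show ?thesis
    by (rule P.integrable_const_bound[of _ "ln (cmod (lin_part T) + cmod (antilin_part T))"])
       (use abs_log_gain_le[OF assms(2)] in auto)
qed

text \<open>Off the diagonal, which is a null set, the logarithm of the distance between the images
  of \<open>x\<close> and \<open>y\<close> is that of \<open>norm (x - y)\<close> plus the gain. The
  push-forward therefore lowers the energy by exactly the mean gain.\<close>

lemma energy_of_image:
  fixes T :: "real ^ 2 ^ 2"
  assumes \<mu>: "\<mu> \<in> borel_prob_measures_on K" and "bounded K" and det: "\<bar>det T\<bar> = 1"
    and fin: "energy_of \<mu> < \<infinity>"
  obtains \<nu> where "\<nu> \<in> borel_prob_measures_on ((*v) T ` K)"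
    and "energy_of \<nu> = energy_of \<mu> - ereal (\<integral>p. log_gain T (fst p - snd p) \<partial>(\<mu> \<Otimes>\<^sub>M \<mu>))"
proof -
  note id[measurable] = borel_prob_measures_onD(3)[OF \<mu>]
  interpret prob_space \<mu> by (rule borel_prob_measures_onD(1)[OF \<mu>])
  interpret P: pair_prob_space \<mu> \<mu> ..
  note sp = borel_prob_measures_onD(2)[OF \<mu>]
  note [measurable] = borel_measurable_fst_snd[OF id]
  let ?P = "\<mu> \<Otimes>\<^sub>M \<mu>"
  obtain D0 where D0: "D0 \<ge> 1" "\<forall>x\<in>K. \<forall>y\<in>K. norm (x - y) \<le> D0"
    using bounded_diameter[OF assms(2)] by blast
  note F = finite_energyD[OF \<mu> D0 fin]
  have "bounded ((*v) T ` K)"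
    by (intro bounded_linear_image assms matrix_vector_mul_bounded_linear)
  then obtain D where D: "D \<ge> 1"
    "\<forall>x\<in>(*v) T ` K. \<forall>y\<in>(*v) T ` K. norm (x - y) \<le> D"
    using bounded_diameter by blast
  \<comment> \<open>Membership in \<open>borel_prob_measures_on\<close> requires the trace
    sigma-algebra on the image set as the target.\<close>
  define B where "B = restrict_space borel ((*v) T ` K)"
  have T[measurable]: "(*v) T \<in> \<mu> \<rightarrow>\<^sub>M B"
    unfolding B_def
    by (intro measurable_restrict_space2) (auto simp: sp intro: measurable_compose[OF id])
  define \<nu> where "\<nu> = distr \<mu> B ((*v) T)"
  have \<nu>: "\<nu> \<in> borel_prob_measures_on ((*v) T ` K)"
    using T by (auto simp: \<nu>_def borel_prob_measures_on_def B_def intro!: prob_space_distr)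
  note id\<nu>[measurable] = borel_prob_measures_onD(3)[OF \<nu>]
  interpret \<nu>: prob_space \<nu> by (rule borel_prob_measures_onD(1)[OF \<nu>])
  let ?k = "\<lambda>x y. e2ennreal (log_kernel x y + ereal (ln D))"
  define g where "g p = ln D - ln (norm (T *v (fst p - snd p)))" for p
  have [measurable]: "g \<in> borel_measurable ?P"
    unfolding g_def by measurable
  have kg: "AE p in ?P. ?k (T *v fst p) (T *v snd p) = ennreal (g p)"
    using F(1)
  proof (rule AE_mp, intro AE_I2 impI)
    fix p :: "(real ^ 2) \<times> (real ^ 2)" assume "fst p \<noteq> snd p"
    then have "norm (T *v (fst p - snd p)) > 0"
      by (intro norm_matvec_pos det) simp
    then show "?k (T *v fst p) (T *v snd p) = ennreal (g p)"
      by (auto simp: g_def log_kernel_def ln_div e2ennreal_ereal matrix_vector_mult_diff_distrib)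
  qed
  have g0: "AE p in ?P. 0 \<le> g p"
    using F(1)
  proof (rule AE_mp, intro AE_I2 impI)
    fix p :: "(real ^ 2) \<times> (real ^ 2)" assume p: "p \<in> space ?P" "fst p \<noteq> snd p"
    then have "norm (T *v (fst p - snd p)) > 0"
      by (intro norm_matvec_pos det) simp
    moreover have "norm (T *v (fst p - snd p)) \<le> D"
      using p D(2) by (auto simp: space_pair_measure sp matrix_vector_mult_diff_distrib)
    ultimately show "0 \<le> g p" by (auto simp: g_def intro!: ln_mono)
  qed
  let ?G = "\<lambda>p. log_gain T (fst p - snd p)" and ?L = "\<lambda>p. ln (norm (fst p - snd p))"
  have Gi: "integrable ?P ?G" by (rule integrable_log_gain[OF \<mu> det])
  have gL: "AE p in ?P. g p = ln D - ?L p - ?G p"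
    using F(1)
  proof (rule AE_mp, intro AE_I2 impI)
    fix p :: "(real ^ 2) \<times> (real ^ 2)" assume p: "p \<in> space ?P" "fst p \<noteq> snd p"
    then have "norm (T *v (fst p - snd p)) > 0"
      by (intro norm_matvec_pos det) simp
    then show "g p = ln D - ?L p - ?G p"
      using p(2) by (simp add: g_def log_gain_def ln_div)
  qed
  have hi: "integrable ?P (\<lambda>p. ln D - ?L p - ?G p)"
    using F(2) Gi by (intro Bochner_Integration.integrable_diff) auto
  have gi: "integrable ?P g"
    using integrable_cong_AE[OF _ _ gL] hi F(2) Gi by auto
  have "(\<integral>\<^sup>+ x. \<integral>\<^sup>+ y. ?k x y \<partial>\<nu> \<partial>\<nu>) = (\<integral>\<^sup>+ x. \<integral>\<^sup>+ y. ?k x (T *v y) \<partial>\<mu> \<partial>\<nu>)"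
    unfolding \<nu>_def by (intro nn_integral_cong nn_integral_distr) (use id\<nu> in \<open>auto simp: \<nu>_def[symmetric]\<close>)
  also have "\<dots> = (\<integral>\<^sup>+ x. \<integral>\<^sup>+ y. ?k (T *v x) (T *v y) \<partial>\<mu> \<partial>\<mu>)"
    unfolding \<nu>_def by (intro nn_integral_distr) (use id\<nu> in \<open>auto simp: \<nu>_def[symmetric]\<close>)
  also have "\<dots> = (\<integral>\<^sup>+ p. ?k (T *v fst p) (T *v snd p) \<partial>?P)"
    by (subst nn_integral_fst[symmetric]) auto
  also have "\<dots> = ennreal (integral\<^sup>L ?P g)"
    unfolding nn_integral_cong_AE[OF kg] by (rule nn_integral_eq_integral[OF gi g0])
  finally have "energy_of \<nu> = ereal (integral\<^sup>L ?P g - ln D)"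
    using integral_nonneg_AE[OF g0] energy_of_shift[OF \<nu> D] by simp
  moreover have "integral\<^sup>L ?P g = (\<integral>p. ln D - ?L p - ?G p \<partial>?P)"
    using hi by (intro integral_cong_AE gL) auto
  moreover have "\<dots> = ln D - integral\<^sup>L ?P ?L - integral\<^sup>L ?P ?G"
    using F(2) Gi by (simp add: Bochner_Integration.integral_diff P.prob_space)
  ultimately have "energy_of \<nu> = energy_of \<mu> - ereal (integral\<^sup>L ?P ?G)"
    using F(3) by simp
  with \<nu> show thesis by (rule that)
qed

section \<open>Comparing the energy of a set and of its image\<close>

lemma bounded_imp_log_energy_gt:
  assumes "bounded K"
  shows "log_energy K > -\<infinity>"
proof -
  obtain D where D: "D \<ge> 1" "\<forall>x\<in>K. \<forall>y\<in>K. norm (x - y) \<le> D"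
    using bounded_diameter[OF assms] by blast
  have "- ereal (ln D) \<le> log_energy K"
    unfolding log_energy_eq using energy_of_ge[OF _ D] by (intro INF_greatest)
  then show ?thesis by auto
qed

text \<open>The map \<open>T\<close> may vary with the measure; only the gain \<open>c\<close> has
  to be uniform. Measures of energy at most \<open>e\<close> suffice because \<open>e\<close> lies
  above the infimum, and for these the bounded energy can be exploited.\<close>

lemma log_energy_image_le:
  assumes K: "bounded K" and e: "log_energy K < ereal e"
    and T: "\<And>\<mu>. \<mu> \<in> borel_prob_measures_on K \<Longrightarrow> energy_of \<mu> \<le> ereal e \<Longrightarrow>
      \<exists>T. (*v) T ` K = L \<and> \<bar>det T\<bar> = 1 \<and>
        c \<le> (\<integral>p. log_gain T (fst p - snd p) \<partial>(\<mu> \<Otimes>\<^sub>M \<mu>))"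
  shows "log_energy L \<le> log_energy K - ereal c"
proof -
  have le: "log_energy L + ereal c \<le> energy_of \<mu>"
    if \<mu>: "\<mu> \<in> borel_prob_measures_on K" and E: "energy_of \<mu> \<le> ereal e" for \<mu>
  proof -
    obtain T where T: "(*v) T ` K = L" "\<bar>det T\<bar> = 1"
      "c \<le> (\<integral>p. log_gain T (fst p - snd p) \<partial>(\<mu> \<Otimes>\<^sub>M \<mu>))"
      using assms(3)[OF \<mu> E] by blast
    have fin: "energy_of \<mu> < \<infinity>" using E by auto
    obtain \<nu> where \<nu>: "\<nu> \<in> borel_prob_measures_on L"
      "energy_of \<nu> = energy_of \<mu> - ereal (\<integral>p. log_gain T (fst p - snd p) \<partial>(\<mu> \<Otimes>\<^sub>M \<mu>))"
      using energy_of_image[OF \<mu> K T(2) fin] T(1) by blast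
    have "log_energy L \<le> energy_of \<nu>"
      unfolding log_energy_eq by (rule INF_lower[OF \<nu>(1)])
    then show ?thesis
      using T(3) fin unfolding \<nu>(2)
      by (cases "energy_of \<mu>"; cases "log_energy L") auto
  qed
  obtain \<mu>0 where \<mu>0: "\<mu>0 \<in> borel_prob_measures_on K" "energy_of \<mu>0 < ereal e"
    using e unfolding log_energy_eq INF_less_iff by blast
  have "log_energy L + ereal c \<le> log_energy K"
    unfolding log_energy_eq[of K]
  proof (rule INF_greatest)
    fix \<mu> assume \<mu>: "\<mu> \<in> borel_prob_measures_on K"
    show "log_energy L + ereal c \<le> energy_of \<mu>"
    proof (cases "energy_of \<mu> \<le> ereal e")
      case True
      then show ?thesis by (rule le[OF \<mu>])
    next
      \<comment> \<open>A measure of energy above \<open>e\<close> is compared with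
        \<open>\<mu>0\<close>, whose energy is smaller.\<close>
      case False
      have "log_energy L + ereal c \<le> energy_of \<mu>0"
        using \<mu>0 by (intro le) auto
      also have "\<dots> \<le> energy_of \<mu>" using \<mu>0(2) False by simp
      finally show ?thesis .
    qed
  qed
  then show ?thesis
    by (cases "log_energy L"; cases "log_energy K") auto
qed

section \<open>Invariance of the energy under orthogonal maps\<close>

lemma log_gain_orthogonal:
  assumes "orthogonal_matrix M"
  shows "log_gain M w = 0"
proof -
  have "norm (M *v w) = norm w"
    using assms orthogonal_transformation_matrix[of "(*v) M"] orthogonal_transformation[of "(*v) M"]
    by simp
  then show ?thesis by (simp add: log_gain_def)
qed

lemma log_energy_orthogonal_image_le:
  assumes "bounded K" and M: "orthogonal_matrix M"
  shows "log_energy ((*v) M ` K) \<le> log_energy K"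
proof (cases "log_energy K")
  case (real v)
  have "\<bar>det M\<bar> = 1"
    using det_orthogonal_matrix[OF M] by auto
  then have "log_energy ((*v) M ` K) \<le> log_energy K - ereal 0"
    using real by (intro log_energy_image_le[where e = "v + 1"] assms exI[of _ M])
      (auto simp: log_gain_orthogonal[OF M])
  then show ?thesis by (simp flip: zero_ereal_def)
qed (use bounded_imp_log_energy_gt[OF assms(1)] in auto)

lemma log_energy_orthogonal_image:
  assumes "bounded K" and M: "orthogonal_matrix M"
  shows "log_energy ((*v) M ` K) = log_energy K"
proof (rule antisym)
  show "log_energy ((*v) M ` K) \<le> log_energy K"
    by (rule log_energy_orthogonal_image_le[OF assms])
  \<comment> \<open>The transpose inverts \<open>M\<close>, so the inequality for orthogonal images,
    applied to it, gives the converse.\<close>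
  have "transpose M *v (M *v x) = x" for x
    using M unfolding matrix_vector_mul_assoc by (simp add: orthogonal_matrix)
  then have "(*v) (transpose M) ` ((*v) M ` K) = K"
    unfolding image_image by simp
  moreover have "bounded ((*v) M ` K)"
    by (intro bounded_linear_image assms matrix_vector_mul_bounded_linear)
  ultimately show "log_energy K \<le> log_energy ((*v) M ` K)"
    using log_energy_orthogonal_image_le[of "(*v) M ` K" "transpose M"] M
    by (simp add: orthogonal_matrix_transpose)
qed

section \<open>Averaging over the rotations of the set\<close>

lemma plane_rotation_multiple_image:
  assumes "(*v) (plane_rotation t) ` K = K"
  shows "(*v) (plane_rotation (real n * t)) ` K = K"
proof (induction n)
  case 0
  have "plane_rotation 0 *v w = w" for w
    by (simp add: cplx_plane_rotation flip: cplx_inject)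
  then show ?case by simp
next
  case (Suc n)
  have "(*v) (plane_rotation (real (Suc n) * t)) ` K =
      (*v) (plane_rotation t) ` (*v) (plane_rotation (real n * t)) ` K"
    by (simp add: image_image plane_rotation_add algebra_simps)
  then show ?case using Suc assms by simp
qed

text \<open>All the maps \<open>M ** plane_rotation (j * \<psi>)\<close> send \<open>K\<close> to
  the same set, and for each measure of finite energy their mean gains add up to at least
  \<open>c\<close>. Hence one of the \<open>m\<close> maps gains at least \<open>c / m\<close>, with
  \<open>c\<close> independent of the measure.\<close>

lemma log_energy_image_le_rotational:
  assumes K: "bounded K" and sym: "(*v) (plane_rotation \<psi>) ` K = K" and fin: "log_energy K < \<infinity>"
    and M: "\<bar>det M\<bar> = 1" and m: "m \<ge> 2" and \<psi>: "cis (2 * \<psi>) = cis (2 * pi / real m)"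
  shows "log_energy ((*v) M ` K) \<le> log_energy K"
    and "m \<ge> 3 \<Longrightarrow> \<not> orthogonal_matrix M \<Longrightarrow> log_energy ((*v) M ` K) < log_energy K"
proof -
  let ?T = "\<lambda>j. M ** plane_rotation (real j * \<psi>)"
  obtain v where v: "log_energy K = ereal v"
    using fin bounded_imp_log_energy_gt[OF K] by (cases "log_energy K") auto
  obtain c where c: "c \<ge> 0" "m \<ge> 3 \<Longrightarrow> \<not> orthogonal_matrix M \<Longrightarrow> c > 0"
    "\<And>w. w \<noteq> 0 \<Longrightarrow> (\<Sum>j<m. log_gain (?T j) w) \<ge> c"
    using sum_log_gain_ge[OF M m \<psi>] by blast
  obtain D where D: "D \<ge> 1" "\<forall>x\<in>K. \<forall>y\<in>K. norm (x - y) \<le> D"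
    using bounded_diameter[OF K] by blast
  have det: "\<bar>det (?T j)\<bar> = 1" for j
    using M by (simp add: det_mul)
  have img: "(*v) (?T j) ` K = (*v) M ` K" for j
  proof -
    have "(*v) (?T j) ` K = (*v) M ` (*v) (plane_rotation (real j * \<psi>)) ` K"
      unfolding image_image matrix_vector_mul_assoc ..
    then show ?thesis unfolding plane_rotation_multiple_image[OF sym] .
  qed
  have "log_energy ((*v) M ` K) \<le> log_energy K - ereal (c / m)"
  proof (rule log_energy_image_le[OF K, of "v + 1"])
    show "log_energy K < ereal (v + 1)" using v by simp
    fix \<mu> assume \<mu>: "\<mu> \<in> borel_prob_measures_on K" and "energy_of \<mu> \<le> ereal (v + 1)"
    then have fin: "energy_of \<mu> < \<infinity>" by auto
    interpret prob_space \<mu> by (rule borel_prob_measures_onD(1)[OF \<mu>])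
    interpret P: pair_prob_space \<mu> \<mu> ..
    let ?P = "\<mu> \<Otimes>\<^sub>M \<mu>"
    let ?G = "\<lambda>j. \<integral>p. log_gain (?T j) (fst p - snd p) \<partial>?P"
    have i: "integrable ?P (\<lambda>p. log_gain (?T j) (fst p - snd p))" for j
      by (rule integrable_log_gain[OF \<mu> det])
    have "c = (\<integral>p. c \<partial>?P)" by (simp add: P.prob_space)
    also have "\<dots> \<le> (\<integral>p. (\<Sum>j<m. log_gain (?T j) (fst p - snd p)) \<partial>?P)"
    proof (rule integral_mono_AE)
      show "AE p in ?P. c \<le> (\<Sum>j<m. log_gain (?T j) (fst p - snd p))"
        using finite_energyD(1)[OF \<mu> D fin] by (rule AE_mp) (auto intro!: c(3))
    qed (auto intro: i)
    also have "\<dots> = (\<Sum>j<m. ?G j)"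
      by (intro Bochner_Integration.integral_sum i)
    finally have "c \<le> (\<Sum>j<m. ?G j)" .
    have "\<exists>j<m. c / m \<le> ?G j"
    proof (rule ccontr)
      assume "\<not> ?thesis"
      then have "(\<Sum>j<m. ?G j) < (\<Sum>j<m. c / m)"
        using m by (intro sum_strict_mono) (auto simp: not_le lessThan_empty_iff)
      then show False using \<open>c \<le> _\<close> m by simp
    qed
    then show "\<exists>T. (*v) T ` K = (*v) M ` K \<and> \<bar>det T\<bar> = 1 \<and>
        c / m \<le> (\<integral>p. log_gain T (fst p - snd p) \<partial>?P)"
      using img det by blast
  qed
  then have le: "log_energy ((*v) M ` K) \<le> ereal (v - c / m)"
    by (simp add: v)
  have "v - c / m \<le> v" using c(1) by simp
  with le show "log_energy ((*v) M ` K) \<le> log_energy K"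
    unfolding v by (meson ereal_less_eq(3) order_trans)
  assume "m \<ge> 3" "\<not> orthogonal_matrix M"
  then have "v - c / m < v" using c(2) m by simp
  with le show "log_energy ((*v) M ` K) < log_energy K"
    unfolding v by (meson less_ereal.simps(1) order_le_less_trans)
qed

section \<open>The strict inequality for four-fold symmetry\<close>

text \<open>If \<open>(x, x') \<in> H\<close> and \<open>(y, y') \<in> V\<close> are independent, then \<open>(x, y)\<close> lies in \<open>H\<close>, \<open>V\<close> or \<open>N\<close>, and in the
  first two cases one of the two pairs, together with \<open>(x, y)\<close>, has one edge of each kind at a common
  point.\<close>

lemma emeasure_mult_le_of_triangles:
  assumes "prob_space \<mu>"
    and [measurable]: "H \<in> sets (\<mu> \<Otimes>\<^sub>M \<mu>)" "V \<in> sets (\<mu> \<Otimes>\<^sub>M \<mu>)"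
      "N \<in> sets (\<mu> \<Otimes>\<^sub>M \<mu>)" "S \<in> sets (\<mu> \<Otimes>\<^sub>M \<mu>)"
    and cover: "space (\<mu> \<Otimes>\<^sub>M \<mu>) \<subseteq> H \<union> V \<union> N"
    and sym: "\<And>x y. (x, y) \<in> H \<Longrightarrow> (y, x) \<in> H"
    and tri: "\<And>x y z. (x, y) \<in> H \<Longrightarrow> (x, z) \<in> V \<Longrightarrow> (y, z) \<in> N \<or> (x, y) \<in> S \<or> (x, z) \<in> S"
  shows "emeasure (\<mu> \<Otimes>\<^sub>M \<mu>) H * emeasure (\<mu> \<Otimes>\<^sub>M \<mu>) V \<le>
    3 * emeasure (\<mu> \<Otimes>\<^sub>M \<mu>) N + 4 * emeasure (\<mu> \<Otimes>\<^sub>M \<mu>) S"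
proof -
  interpret prob_space \<mu> by fact
  interpret P: pair_prob_space \<mu> \<mu> ..
  let ?P = "\<mu> \<Otimes>\<^sub>M \<mu>"
  let ?I = "\<lambda>A x y. indicator A (x, y) :: ennreal"
  \<comment> \<open>For a fixed point \<open>x\<close>, these are the probabilities that the pair of
    \<open>x\<close> with a random point lies in \<open>H\<close> or in \<open>V\<close>.\<close>
  define h v where "h x = (\<integral>\<^sup>+ y. ?I H x y \<partial>\<mu>)" and "v x = (\<integral>\<^sup>+ y. ?I V x y \<partial>\<mu>)" for x
  have [measurable]: "h \<in> borel_measurable \<mu>" "v \<in> borel_measurable \<mu>"
    unfolding h_def v_def by measurable
  have em: "(\<integral>\<^sup>+ x. \<integral>\<^sup>+ y. ?I A x y \<partial>\<mu> \<partial>\<mu>) = emeasure ?P A" if "A \<in> sets ?P" for A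
    using that by (simp add: emeasure_pair_measure)
  have hH: "(\<integral>\<^sup>+ x. h x \<partial>\<mu>) = emeasure ?P H" and vV: "(\<integral>\<^sup>+ x. v x \<partial>\<mu>) = emeasure ?P V"
    by (simp_all add: h_def v_def em)
  have le1: "(\<integral>\<^sup>+ y. ?I A x y \<partial>\<mu>) \<le> 1" for A x
  proof -
    have "(\<integral>\<^sup>+ y. ?I A x y \<partial>\<mu>) \<le> (\<integral>\<^sup>+ y. 1 \<partial>\<mu>)"
      by (intro nn_integral_mono) (simp add: indicator_def)
    then show ?thesis by (simp add: emeasure_space_1)
  qed
  have "(\<integral>\<^sup>+ x. h x * v x \<partial>\<mu>) = (\<integral>\<^sup>+ x. \<integral>\<^sup>+ y. \<integral>\<^sup>+ z. ?I H x y * ?I V x z \<partial>\<mu> \<partial>\<mu> \<partial>\<mu>)"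
    unfolding h_def v_def
    by (intro nn_integral_cong) (simp add: nn_integral_cmult nn_integral_multc)
  \<comment> \<open>The left side is the probability that two independent edges from the same point
    \<open>x\<close> are of different kinds; \<open>tri\<close> bounds its integrand.\<close>
  also have "\<dots> \<le> (\<integral>\<^sup>+ x. \<integral>\<^sup>+ y. \<integral>\<^sup>+ z. ?I N y z + (?I S x y + ?I S x z) \<partial>\<mu> \<partial>\<mu> \<partial>\<mu>)"
    using tri by (intro nn_integral_mono) (auto simp: indicator_def)
  also have "\<dots> = (\<integral>\<^sup>+ x. emeasure ?P N + ((\<integral>\<^sup>+ y. ?I S x y \<partial>\<mu>) + (\<integral>\<^sup>+ z. ?I S x z \<partial>\<mu>)) \<partial>\<mu>)"
  proof (intro nn_integral_cong)
    fix x assume [measurable]: "x \<in> space \<mu>"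
    have "(\<integral>\<^sup>+ y. \<integral>\<^sup>+ z. ?I N y z + (?I S x y + ?I S x z) \<partial>\<mu> \<partial>\<mu>) =
        (\<integral>\<^sup>+ y. (\<integral>\<^sup>+ z. ?I N y z \<partial>\<mu>) + (?I S x y + (\<integral>\<^sup>+ z. ?I S x z \<partial>\<mu>)) \<partial>\<mu>)"
      by (intro nn_integral_cong) (simp add: nn_integral_add emeasure_space_1)
    also have "\<dots> = emeasure ?P N + ((\<integral>\<^sup>+ y. ?I S x y \<partial>\<mu>) + (\<integral>\<^sup>+ z. ?I S x z \<partial>\<mu>))"
      by (simp add: nn_integral_add em emeasure_space_1)
    finally show "(\<integral>\<^sup>+ y. \<integral>\<^sup>+ z. ?I N y z + (?I S x y + ?I S x z) \<partial>\<mu> \<partial>\<mu>) = \<dots>" .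
  qed
  also have "\<dots> = emeasure ?P N + 2 * emeasure ?P S"
    by (simp add: nn_integral_add em emeasure_space_1 mult_2)
  finally have hv: "(\<integral>\<^sup>+ x. h x * v x \<partial>\<mu>) \<le> emeasure ?P N + 2 * emeasure ?P S" .
  \<comment> \<open>The left side integrates to the product of the measures of \<open>H\<close> and
    \<open>V\<close>. On \<open>V\<close> the factor \<open>v y\<close> is dropped and on
    \<open>H\<close> the factor \<open>h x\<close>, so that both remaining terms integrate to the
    mean of \<open>h x * v x\<close>.\<close>
  have pw: "h x * v y \<le> ?I N x y + (h x * ?I V x y + v y * ?I H x y)"
    if xy: "x \<in> space \<mu>" "y \<in> space \<mu>" for x y
  proof -
    have "h x \<le> 1" "v y \<le> 1" unfolding h_def v_def by (rule le1)+
    then have *: "h x * v y \<le> 1" "h x * v y \<le> h x" "h x * v y \<le> v y"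
      using mult_mono[of "h x" 1 "v y" 1] mult_left_mono[of "v y" 1 "h x"]
        mult_right_mono[of "h x" 1 "v y"] by auto
    consider "(x, y) \<in> N" | "(x, y) \<in> V" | "(x, y) \<in> H"
      using subsetD[OF cover, of "(x, y)"] xy by (auto simp: space_pair_measure)
    then show ?thesis
    proof cases
      case 1
      with *(1) have "h x * v y \<le> ?I N x y" by simp
      then show ?thesis by (rule add_increasing2[OF zero_le])
    next
      case 2
      with *(2) have "h x * v y \<le> h x * ?I V x y" by simp
      then have "h x * v y \<le> h x * ?I V x y + v y * ?I H x y" by (rule add_increasing2[OF zero_le])
      then show ?thesis by (rule add_increasing[OF zero_le])
    next
      case 3
      with *(3) have "h x * v y \<le> v y * ?I H x y" by simp
      then have "h x * v y \<le> h x * ?I V x y + v y * ?I H x y" by (rule add_increasing[OF zero_le])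
      then show ?thesis by (rule add_increasing[OF zero_le])
    qed
  qed
  have "emeasure ?P H * emeasure ?P V = (\<integral>\<^sup>+ x. \<integral>\<^sup>+ y. h x * v y \<partial>\<mu> \<partial>\<mu>)"
    by (simp add: nn_integral_cmult nn_integral_multc hH vV)
  also have "\<dots> \<le> (\<integral>\<^sup>+ x. \<integral>\<^sup>+ y. ?I N x y + (h x * ?I V x y + v y * ?I H x y) \<partial>\<mu> \<partial>\<mu>)"
    by (intro nn_integral_mono pw)
  also have "\<dots> = emeasure ?P N + ((\<integral>\<^sup>+ x. h x * v x \<partial>\<mu>) + (\<integral>\<^sup>+ x. \<integral>\<^sup>+ y. v y * ?I H x y \<partial>\<mu> \<partial>\<mu>))"
  proof -
    have "(\<integral>\<^sup>+ x. \<integral>\<^sup>+ y. ?I N x y + (h x * ?I V x y + v y * ?I H x y) \<partial>\<mu> \<partial>\<mu>) =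
        (\<integral>\<^sup>+ x. (\<integral>\<^sup>+ y. ?I N x y \<partial>\<mu>) + (h x * v x + (\<integral>\<^sup>+ y. v y * ?I H x y \<partial>\<mu>)) \<partial>\<mu>)"
      by (intro nn_integral_cong) (simp add: nn_integral_add nn_integral_cmult v_def)
    then show ?thesis by (simp add: nn_integral_add em)
  qed
  also have "(\<integral>\<^sup>+ x. \<integral>\<^sup>+ y. v y * ?I H x y \<partial>\<mu> \<partial>\<mu>) = (\<integral>\<^sup>+ y. \<integral>\<^sup>+ x. v y * ?I H x y \<partial>\<mu> \<partial>\<mu>)"
    by (intro P.Fubini') measurable
  also have "\<dots> = (\<integral>\<^sup>+ y. v y * h y \<partial>\<mu>)"
  proof (intro nn_integral_cong)
    fix y assume [measurable]: "y \<in> space \<mu>"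
    \<comment> \<open>The symmetry of \<open>H\<close> lets the integral over the first coordinate
      be read as \<open>h y\<close>.\<close>
    have "?I H x y = ?I H y x" for x
      using sym by (auto simp: indicator_def)
    then show "(\<integral>\<^sup>+ x. v y * ?I H x y \<partial>\<mu>) = v y * h y"
      by (simp add: nn_integral_cmult h_def)
  qed
  also have "\<dots> = (\<integral>\<^sup>+ x. h x * v x \<partial>\<mu>)"
    by (simp add: mult.commute)
  also have "emeasure ?P N + ((\<integral>\<^sup>+ x. h x * v x \<partial>\<mu>) + (\<integral>\<^sup>+ x. h x * v x \<partial>\<mu>)) \<le>
      emeasure ?P N + ((emeasure ?P N + 2 * emeasure ?P S) + (emeasure ?P N + 2 * emeasure ?P S))"
    by (intro add_mono hv order_refl)
  also have "\<dots> = 3 * emeasure ?P N + 4 * emeasure ?P S"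
  proof -
    have "3 = (1 + 1 + 1 :: ennreal)" "4 = (2 + 2 :: ennreal)" by simp_all
    then show ?thesis by (simp only: distrib_right) (simp add: add_ac)
  qed
  finally show ?thesis .
qed

text \<open>The second edge is short: its height is at most the sum of the heights of the other two
  edges, hence at most \<open>2 * e * \<bar>x1\<bar> + e * \<bar>x2\<bar>\<close>. The last term is
  at most a quarter of \<open>\<bar>y2\<bar>\<close> and is absorbed. Exchanging the coordinates
  covers a third edge near the other axis.\<close>

lemma near_axes_triangle:
  fixes x1 y1 x2 y2 e :: real
  assumes e: "0 < e" "e \<le> 1 / 2"
    and 1: "\<bar>y1\<bar> < e * \<bar>x1\<bar>" and 2: "\<bar>x2\<bar> < e * \<bar>y2\<bar>" and 3: "\<bar>y2 - y1\<bar> < e * \<bar>x2 - x1\<bar>"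
  shows "\<bar>x2\<bar> + \<bar>y2\<bar> \<le> 6 * e * \<bar>x1\<bar>"
proof -
  have "e * \<bar>x2 - x1\<bar> \<le> e * (\<bar>x2\<bar> + \<bar>x1\<bar>)"
    using e by (intro mult_left_mono) auto
  moreover have "e * \<bar>x2\<bar> \<le> e * (e * \<bar>y2\<bar>)"
    using e 2 by (intro mult_left_mono) auto
  moreover have "e * (e * \<bar>y2\<bar>) \<le> 1 / 2 * (1 / 2 * \<bar>y2\<bar>)" "e * \<bar>y2\<bar> \<le> 1 / 2 * \<bar>y2\<bar>"
    using e by (intro mult_mono mult_right_mono; simp)+
  ultimately have "\<bar>y2\<bar> \<le> 2 * (e * \<bar>x1\<bar>) + 1 / 4 * \<bar>y2\<bar>"
    using 1 3 by (simp add: distrib_left) linarith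
  moreover have "\<bar>x2\<bar> \<le> 1 / 2 * \<bar>y2\<bar>" using 2 \<open>e * \<bar>y2\<bar> \<le> 1 / 2 * \<bar>y2\<bar>\<close> by linarith
  ultimately show ?thesis using e by simp
qed

text \<open>The logarithmic gain of the diagonal matrix with entries \<open>s\<close> and \<open>1 / s\<close> at the vector \<open>(x, y)\<close>.\<close>

definition axis_gain :: "real \<Rightarrow> real \<Rightarrow> real \<Rightarrow> real" where
  "axis_gain s x y = ln ((s\<^sup>2 * x\<^sup>2 + y\<^sup>2 / s\<^sup>2) / (x\<^sup>2 + y\<^sup>2)) / 2"

text \<open>The quotient under the logarithm is a weighted mean of \<open>s^2\<close> and
  \<open>1 / s^2\<close>. At the origin the default values \<open>0 / 0 = 0\<close> and
  \<open>ln 0 = 0\<close> make the gain 0.\<close>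

lemma axis_gain_ge:
  assumes "s \<ge> 1"
  shows "axis_gain s x y \<ge> - ln s"
proof (cases "x\<^sup>2 + y\<^sup>2 = 0")
  case True
  then show ?thesis using assms by (simp add: axis_gain_def)
next
  case False
  then have p: "x\<^sup>2 + y\<^sup>2 > 0" by (simp add: sum_power2_gt_zero_iff)
  have "x\<^sup>2 / s\<^sup>2 \<le> s\<^sup>2 * x\<^sup>2"
  proof -
    have "x\<^sup>2 / s\<^sup>2 \<le> x\<^sup>2 / 1" using assms by (intro divide_left_mono) auto
    moreover have "1 * x\<^sup>2 \<le> s\<^sup>2 * x\<^sup>2" using assms by (intro mult_right_mono) auto
    ultimately show ?thesis by simp
  qed
  then have "1 / s\<^sup>2 \<le> (s\<^sup>2 * x\<^sup>2 + y\<^sup>2 / s\<^sup>2) / (x\<^sup>2 + y\<^sup>2)"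
    using p by (subst pos_le_divide_eq) (simp_all add: distrib_left)
  then have "ln (1 / s\<^sup>2) \<le> ln ((s\<^sup>2 * x\<^sup>2 + y\<^sup>2 / s\<^sup>2) / (x\<^sup>2 + y\<^sup>2))"
    using assms by (intro ln_mono) auto
  moreover have "ln (1 / s\<^sup>2) = - (2 * ln s)"
    using assms by (simp add: ln_div ln_realpow)
  ultimately show ?thesis by (simp add: axis_gain_def)
qed

text \<open>The first term alone bounds the quotient below by \<open>s^2 / (1 + e^2)\<close>, hence
  by \<open>s\<close>.\<close>

lemma axis_gain_near_axis:
  assumes s: "s \<ge> 1" and e: "1 + e\<^sup>2 \<le> s" and y: "\<bar>y\<bar> < e * \<bar>x\<bar>"
  shows "axis_gain s x y \<ge> ln s / 2"
proof -
  have x: "x\<^sup>2 > 0" using y by (cases "x = 0") auto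
  have "\<bar>y\<bar>\<^sup>2 \<le> (e * \<bar>x\<bar>)\<^sup>2" using y by (intro power_mono) auto
  then have "x\<^sup>2 + y\<^sup>2 \<le> (1 + e\<^sup>2) * x\<^sup>2" by (simp add: power_mult_distrib algebra_simps)
  also have "\<dots> \<le> s * x\<^sup>2" using e by (intro mult_right_mono) auto
  finally have "s * (x\<^sup>2 + y\<^sup>2) \<le> s * (s * x\<^sup>2)" using s by (intro mult_left_mono) auto
  also have "\<dots> \<le> s\<^sup>2 * x\<^sup>2 + y\<^sup>2 / s\<^sup>2" by (simp add: power2_eq_square mult.assoc)
  finally have "s \<le> (s\<^sup>2 * x\<^sup>2 + y\<^sup>2 / s\<^sup>2) / (x\<^sup>2 + y\<^sup>2)"
    using x by (subst pos_le_divide_eq) (auto intro: add_pos_nonneg)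
  then have "ln s \<le> ln ((s\<^sup>2 * x\<^sup>2 + y\<^sup>2 / s\<^sup>2) / (x\<^sup>2 + y\<^sup>2))"
    using s by (intro ln_mono) auto
  then show ?thesis by (simp add: axis_gain_def)
qed

text \<open>With \<open>t = s^2\<close>, \<open>u = x^2\<close>, \<open>v = y^2\<close> the product
  of the two numerators exceeds \<open>(u + v)^2\<close> by \<open>(t - 1 / t)^2 * u * v\<close>.
  Staying away from both axes makes \<open>u * v\<close> comparable to \<open>(u + v)^2\<close>. The
  case \<open>e = 0\<close> gives nonnegativity of the sum at every nonzero vector.\<close>

lemma axis_gain_add_ge:
  assumes s: "s \<ge> 1" and n: "x \<noteq> 0 \<or> y \<noteq> 0"
    and e: "0 \<le> e" "e \<le> 1" and xy: "e * \<bar>x\<bar> \<le> \<bar>y\<bar>" "e * \<bar>y\<bar> \<le> \<bar>x\<bar>"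
  shows "axis_gain s x y + axis_gain s y x \<ge> ln (1 + (s\<^sup>2 - 1 / s\<^sup>2)\<^sup>2 * e\<^sup>2 / 4) / 2"
proof -
  define t u v where "t = s\<^sup>2" and "u = x\<^sup>2" and "v = y\<^sup>2"
  have t: "t > 0" using s by (simp add: t_def)
  have uv: "u + v > 0" "u \<ge> 0" "v \<ge> 0"
    using n by (auto simp: u_def v_def sum_power2_gt_zero_iff)
  have "(e * \<bar>x\<bar>)\<^sup>2 \<le> \<bar>y\<bar>\<^sup>2" "(e * \<bar>y\<bar>)\<^sup>2 \<le> \<bar>x\<bar>\<^sup>2"
    using xy e by (intro power_mono; simp)+
  then have euv: "e\<^sup>2 * u \<le> v" "e\<^sup>2 * v \<le> u"
    by (auto simp: u_def v_def power_mult_distrib)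
  have "e\<^sup>2 * (u + v)\<^sup>2 \<le> 4 * (u * v)"
  proof (cases "u \<le> v")
    case True
    then have "e\<^sup>2 * (u + v)\<^sup>2 \<le> e\<^sup>2 * (v + v)\<^sup>2"
      using uv by (intro mult_left_mono power_mono) auto
    also have "\<dots> = 4 * ((e\<^sup>2 * v) * v)" by (simp add: power2_eq_square)
    also have "\<dots> \<le> 4 * (u * v)" using euv uv by (intro mult_left_mono mult_right_mono) auto
    finally show ?thesis .
  next
    case False
    then have "e\<^sup>2 * (u + v)\<^sup>2 \<le> e\<^sup>2 * (u + u)\<^sup>2"
      using uv by (intro mult_left_mono power_mono) auto
    also have "\<dots> = 4 * (u * (e\<^sup>2 * u))" by (simp add: power2_eq_square)
    also have "\<dots> \<le> 4 * (u * v)" using euv uv by (intro mult_left_mono) auto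
    finally show ?thesis .
  qed
  then have "(t - 1 / t)\<^sup>2 * (e\<^sup>2 * (u + v)\<^sup>2) \<le> (t - 1 / t)\<^sup>2 * (4 * (u * v))"
    by (intro mult_left_mono) auto
  moreover have "(t * u + v / t) * (t * v + u / t) = (u + v)\<^sup>2 + (t - 1 / t)\<^sup>2 * (u * v)"
    using t by (simp add: field_simps power2_eq_square)
  ultimately have "(1 + (t - 1 / t)\<^sup>2 * e\<^sup>2 / 4) * (u + v)\<^sup>2 \<le> (t * u + v / t) * (t * v + u / t)"
    by (simp add: algebra_simps)
  then have *: "1 + (t - 1 / t)\<^sup>2 * e\<^sup>2 / 4 \<le>
      ((t * u + v / t) / (u + v)) * ((t * v + u / t) / (v + u))"
    using uv by (simp add: pos_le_divide_eq power2_eq_square add.commute[of v u])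
  have pos: "t * u + v / t > 0" "t * v + u / t > 0"
    using uv t by (cases "u = 0"; cases "v = 0"; auto intro: add_pos_nonneg add_nonneg_pos)+
  have "ln (1 + (t - 1 / t)\<^sup>2 * e\<^sup>2 / 4) \<le>
      ln (((t * u + v / t) / (u + v)) * ((t * v + u / t) / (v + u)))"
    using * by (intro ln_mono) (auto intro: add_pos_nonneg)
  also have "\<dots> = ln ((t * u + v / t) / (u + v)) + ln ((t * v + u / t) / (v + u))"
    using pos uv by (intro ln_mult_pos) auto
  finally show ?thesis
    by (simp add: axis_gain_def t_def u_def v_def)
qed

text \<open>This is the singular value decomposition in complex form: with
  \<open>z' = \<gamma> * z\<close>, the map is
  \<open>z \<mapsto> \<delta> * (a * z' + b * cnj z')\<close> for unit \<open>\<gamma>\<close>,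
  \<open>\<delta>\<close> and the moduli \<open>a\<close>, \<open>b\<close>. It scales the real part
  by \<open>a + b\<close> and the imaginary part by \<open>a - b\<close>, which is
  \<open>1 / s\<close> up to sign. A quarter turn multiplies \<open>z'\<close> by the imaginary unit
  and so exchanges the two coordinates.\<close>

lemma log_gain_eq_axis_gain:
  assumes M: "\<bar>det M\<bar> = 1" and no: "\<not> orthogonal_matrix M"
  obtains \<gamma> s where "cmod \<gamma> = 1" and "s > 1"
    and "\<And>w. log_gain M w = axis_gain s (Re (\<gamma> * cplx w)) (Im (\<gamma> * cplx w))"
    and "\<And>w. log_gain (M ** plane_rotation (pi / 2)) w = axis_gain s (Im (\<gamma> * cplx w)) (Re (\<gamma> * cplx w))"
proof -
  define a b where "a = cmod (lin_part M)" and "b = cmod (antilin_part M)"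
  have ab: "a > 0" "b > 0"
    using orthogonal_matrix_if_part_eq_0[OF M] no by (auto simp: a_def b_def)
  \<comment> \<open>multiplication by \<open>\<gamma>\<close> turns the right singular vectors of \<open>M\<close> into the coordinate axes\<close>
  define \<gamma> where "\<gamma> = csqrt ((lin_part M / a) * cnj (antilin_part M / b))"
  define \<delta> where "\<delta> = (lin_part M / a) * cnj \<gamma>"
  have \<gamma>2: "\<gamma> * \<gamma> = (lin_part M / a) * cnj (antilin_part M / b)"
    unfolding \<gamma>_def by (simp add: flip: power2_eq_square)
  have n1: "cmod (lin_part M / a) = 1" "cmod (antilin_part M / b) = 1"
    using ab by (auto simp: norm_divide a_def b_def)
  have \<gamma>: "cmod \<gamma> = 1"
  proof -
    have "cmod \<gamma> * cmod \<gamma> = 1"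
      unfolding norm_mult[symmetric] \<gamma>2 unfolding norm_mult complex_mod_cnj n1 by simp
    then show ?thesis by (metis norm_ge_zero power2_eq_1_iff power2_eq_square zero_le_one neg_0_le_iff_le not_one_le_zero)
  qed
  have unit: "z * cnj z = 1" if "cmod z = 1" for z
    using that by (simp add: complex_norm_square[symmetric])
  have \<delta>: "cmod \<delta> = 1" unfolding \<delta>_def norm_mult complex_mod_cnj \<gamma> n1 by simp
  have l: "lin_part M = a * \<delta> * \<gamma>"
  proof -
    have "a * \<delta> * \<gamma> = a * (lin_part M / a) * (\<gamma> * cnj \<gamma>)" by (simp add: \<delta>_def)
    then show ?thesis using ab unit[OF \<gamma>] by simp
  qed
  have al: "antilin_part M = b * \<delta> * cnj \<gamma>"
  proof -
    have "b * \<delta> * cnj \<gamma> = b * (lin_part M / a) * cnj (\<gamma> * \<gamma>)" by (simp add: \<delta>_def)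
    also have "\<dots> = b * (antilin_part M / b) * ((lin_part M / a) * cnj (lin_part M / a))"
      unfolding \<gamma>2 by simp
    also have "\<dots> = antilin_part M" using unit[OF n1(1)] ab by (simp del: complex_cnj_divide)
    finally show ?thesis ..
  qed
  define s where "s = a + b"
  have d1: "\<bar>a\<^sup>2 - b\<^sup>2\<bar> = 1" using M cmod_parts_det[of M] by (simp add: a_def b_def)
  have "a\<^sup>2 - b\<^sup>2 = s * (a - b)" by (simp add: s_def power2_eq_square algebra_simps)
  then have sd: "s * \<bar>a - b\<bar> = 1" using d1 ab by (simp add: abs_mult s_def)
  have s0: "s > 0" using ab by (simp add: s_def)
  have s1: "s > 1"
  proof (rule ccontr)
    assume "\<not> s > 1"
    then have "s * \<bar>a - b\<bar> \<le> 1 * \<bar>a - b\<bar>" by (intro mult_right_mono) auto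
    then have "1 \<le> \<bar>a - b\<bar>" using sd by simp
    then show False using \<open>\<not> s > 1\<close> ab by (simp add: s_def abs_if split: if_splits)
  qed
  have d2: "(a - b)\<^sup>2 = 1 / s\<^sup>2"
  proof -
    have "s\<^sup>2 * (a - b)\<^sup>2 = (s * \<bar>a - b\<bar>)\<^sup>2" by (simp add: power_mult_distrib)
    then show ?thesis using sd s0 by (simp add: field_simps)
  qed
  have ellipse: "(cmod (a * w + b * cnj w))\<^sup>2 = (s * Re w)\<^sup>2 + ((a - b) * Im w)\<^sup>2" for w :: complex
    unfolding cmod_power2 by (simp add: s_def algebra_simps)
  have key: "(cmod (lin_part M * z + antilin_part M * cnj z))\<^sup>2 =
      s\<^sup>2 * (Re (\<gamma> * z))\<^sup>2 + (Im (\<gamma> * z))\<^sup>2 / s\<^sup>2" for z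
  proof -
    have "lin_part M * z + antilin_part M * cnj z = \<delta> * (a * (\<gamma> * z) + b * cnj (\<gamma> * z))"
      unfolding l al by (simp add: algebra_simps)
    then have "(cmod (lin_part M * z + antilin_part M * cnj z))\<^sup>2 =
        (cmod (a * (\<gamma> * z) + b * cnj (\<gamma> * z)))\<^sup>2"
      by (simp add: norm_mult \<delta>)
    also have "\<dots> = (s * Re (\<gamma> * z))\<^sup>2 + ((a - b) * Im (\<gamma> * z))\<^sup>2"
      by (rule ellipse)
    also have "\<dots> = s\<^sup>2 * (Re (\<gamma> * z))\<^sup>2 + (Im (\<gamma> * z))\<^sup>2 / s\<^sup>2"
      unfolding power_mult_distrib d2 by simp
    finally show ?thesis .
  qed
  have nw: "(norm w)\<^sup>2 = (Re (\<gamma> * cplx w))\<^sup>2 + (Im (\<gamma> * cplx w))\<^sup>2" for w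
    unfolding cmod_power2[symmetric] by (simp add: norm_mult \<gamma> norm_cplx)
  \<comment> \<open>Passing to squares explains the factor 1/2 in \<open>axis_gain\<close>; a zero
    quotient is covered by \<open>ln 0 = 0\<close>.\<close>
  have half: "ln (p / q) = ln (p\<^sup>2 / q\<^sup>2) / 2" if "p \<ge> 0" "q \<ge> 0" for p q :: real
  proof (cases "p / q = 0")
    case False
    then have "p / q > 0" using that by (metis divide_nonneg_nonneg less_eq_real_def)
    then show ?thesis by (simp add: ln_realpow flip: power_divide)
  qed (auto simp: power_divide)
  have A: "log_gain M w = axis_gain s (Re (\<gamma> * cplx w)) (Im (\<gamma> * cplx w))" for w
  proof -
    have "(norm (M *v w))\<^sup>2 = s\<^sup>2 * (Re (\<gamma> * cplx w))\<^sup>2 + (Im (\<gamma> * cplx w))\<^sup>2 / s\<^sup>2"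
      unfolding norm_cplx[symmetric] cplx_matvec key ..
    then show ?thesis
      unfolding log_gain_def axis_gain_def half[OF norm_ge_zero norm_ge_zero] nw[of w] by simp
  qed
  have rot: "cplx (plane_rotation (pi / 2) *v w) = \<i> * cplx w" for w
    by (simp add: cplx_plane_rotation)
  have B: "log_gain (M ** plane_rotation (pi / 2)) w =
      axis_gain s (Im (\<gamma> * cplx w)) (Re (\<gamma> * cplx w))" for w
  proof -
    have "(norm ((M ** plane_rotation (pi / 2)) *v w))\<^sup>2 =
        s\<^sup>2 * (Re (\<gamma> * (\<i> * cplx w)))\<^sup>2 + (Im (\<gamma> * (\<i> * cplx w)))\<^sup>2 / s\<^sup>2"
      unfolding matrix_vector_mul_assoc[symmetric] norm_cplx[symmetric] cplx_matvec[of M] rot key ..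
    also have "\<gamma> * (\<i> * cplx w) = \<i> * (\<gamma> * cplx w)" by simp
    finally have "(norm ((M ** plane_rotation (pi / 2)) *v w))\<^sup>2 =
        s\<^sup>2 * (Im (\<gamma> * cplx w))\<^sup>2 + (Re (\<gamma> * cplx w))\<^sup>2 / s\<^sup>2"
      by (simp only: Re_i_times Im_i_times power2_minus)
    then show ?thesis
      unfolding log_gain_def axis_gain_def half[OF norm_ge_zero norm_ge_zero] nw[of w]
      by (simp add: add.commute)
  qed
  show thesis by (rule that[OF \<gamma> s1 A B])
qed

text \<open>Markov's inequality for \<open>ln D - ln (norm (x - y))\<close>, which is nonnegative
  almost everywhere and has mean \<open>ln D\<close> plus the energy.\<close>

lemma measure_close_le:
  assumes \<mu>: "\<mu> \<in> borel_prob_measures_on K" and D: "D \<ge> 1" "\<forall>x\<in>K. \<forall>y\<in>K. norm (x - y) \<le> D"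
    and E: "energy_of \<mu> \<le> ereal C" and l: "l > 0"
  shows "measure (\<mu> \<Otimes>\<^sub>M \<mu>) {p \<in> space (\<mu> \<Otimes>\<^sub>M \<mu>). norm (fst p - snd p) \<le> D * exp (- l)}
    \<le> (ln D + C) / l"
proof -
  note id[measurable] = borel_prob_measures_onD(3)[OF \<mu>]
  interpret prob_space \<mu> by (rule borel_prob_measures_onD(1)[OF \<mu>])
  interpret P: pair_prob_space \<mu> \<mu> ..
  note sp = borel_prob_measures_onD(2)[OF \<mu>]
  note [measurable] = borel_measurable_fst_snd[OF id]
  let ?P = "\<mu> \<Otimes>\<^sub>M \<mu>"
  define S where "S = {p \<in> space ?P. norm (fst p - snd p) \<le> D * exp (- l)}"
  have [measurable]: "S \<in> sets ?P" unfolding S_def by measurable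
  have fin: "energy_of \<mu> < \<infinity>" using E by auto
  note F = finite_energyD[OF \<mu> D fin]
  have "l * measure ?P S = (\<integral>p. l * indicator S p \<partial>?P)" by simp
  also have "\<dots> \<le> (\<integral>p. ln D - ln (norm (fst p - snd p)) \<partial>?P)"
  proof (rule integral_mono_AE)
    show "integrable ?P (\<lambda>p. l * indicator S p)" by (intro integrable_mult_right integrable_real_indicator) (auto simp: P.emeasure_eq_measure)
    show "AE p in ?P. l * indicator S p \<le> ln D - ln (norm (fst p - snd p))"
      using F(1)
    proof (rule AE_mp, intro AE_I2 impI)
      fix p :: "(real ^ 2) \<times> (real ^ 2)" assume p: "p \<in> space ?P" "fst p \<noteq> snd p"
      let ?n = "norm (fst p - snd p)"
      have n: "?n > 0" "?n \<le> D"
        using p D(2) by (auto simp: space_pair_measure sp)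
      have "ln ?n \<le> ln D" using n by (intro ln_mono) auto
      moreover have "ln ?n \<le> ln D - l" if "p \<in> S"
      proof -
        have "ln ?n \<le> ln (D * exp (- l))"
          using that n by (intro ln_mono) (auto simp: S_def)
        also have "\<dots> = ln D - l" using D(1) by (simp add: ln_mult)
        finally show ?thesis .
      qed
      ultimately show "l * indicator S p \<le> ln D - ln ?n"
        by (auto simp: indicator_def)
    qed
  qed (use F(2) in auto)
  also have "\<dots> = ln D + (- (\<integral>p. ln (norm (fst p - snd p)) \<partial>?P))"
    using F(2) by (simp add: Bochner_Integration.integral_diff P.prob_space)
  also have "\<dots> \<le> ln D + C" using E unfolding F(3) by simp
  finally show ?thesis
    using l by (simp add: S_def pos_le_divide_eq mult.commute)
qed

text \<open>The bound \<open>d\<close> depends on \<open>K\<close>, \<open>M\<close> and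
  \<open>C\<close> but not on the measure. If both gains were below \<open>d\<close>, the measures
  of the pairs near the two axes would contradict the triangle estimate.\<close>

lemma quarter_turn_gain:
  assumes K: "bounded K" and M: "\<bar>det M\<bar> = 1" and no: "\<not> orthogonal_matrix M"
  obtains d where "d > 0" and "\<And>\<mu>. \<mu> \<in> borel_prob_measures_on K \<Longrightarrow> energy_of \<mu> \<le> ereal C \<Longrightarrow>
    d \<le> (\<integral>p. log_gain M (fst p - snd p) \<partial>(\<mu> \<Otimes>\<^sub>M \<mu>)) \<or>
    d \<le> (\<integral>p. log_gain (M ** plane_rotation (pi / 2)) (fst p - snd p) \<partial>(\<mu> \<Otimes>\<^sub>M \<mu>))"
proof -
  obtain D where D: "D \<ge> 1" "\<forall>x\<in>K. \<forall>y\<in>K. norm (x - y) \<le> D"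
    using bounded_diameter[OF K] by blast
  obtain \<gamma> s where \<gamma>: "cmod \<gamma> = 1" and s: "s > 1"
    and gA: "\<And>w. log_gain M w = axis_gain s (Re (\<gamma> * cplx w)) (Im (\<gamma> * cplx w))"
    and gB: "\<And>w. log_gain (M ** plane_rotation (pi / 2)) w =
      axis_gain s (Im (\<gamma> * cplx w)) (Re (\<gamma> * cplx w))"
    using log_gain_eq_axis_gain[OF M no] by blast
  define X Y where "X w = Re (\<gamma> * cplx w)" and "Y w = Im (\<gamma> * cplx w)" for w
  have Xd: "X (a - b) = X a - X b" "Y (a - b) = Y a - Y b" for a b
    by (simp_all add: X_def Y_def cplx_def algebra_simps)
  have nXY: "norm w \<le> \<bar>X w\<bar> + \<bar>Y w\<bar>" and Xn: "\<bar>X w\<bar> \<le> norm w" and Yn: "\<bar>Y w\<bar> \<le> norm w" for w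
    using cmod_le[of "\<gamma> * cplx w"] abs_Re_le_cmod[of "\<gamma> * cplx w"] abs_Im_le_cmod[of "\<gamma> * cplx w"]
    by (simp_all add: X_def Y_def norm_mult \<gamma> norm_cplx)
  have meas[measurable]: "X \<in> borel_measurable borel" "Y \<in> borel_measurable borel"
    unfolding X_def Y_def cplx_def by (intro borel_measurable_continuous_onI; simp; intro continuous_intros)+
  \<comment> \<open>With this \<open>l\<close> the Markov bound \<open>(ln D + C) / l\<close> is at
    most \<open>1 / 100\<close>.\<close>
  define l where "l = 100 * (\<bar>C\<bar> + ln D + 1)"
  have lnD: "ln D \<ge> 0" using D by simp
  have l: "l > 0" using lnD by (simp add: l_def)
  \<comment> \<open>The first entry makes the short edges of \<open>near_axes_triangle\<close> at
    most \<open>D * exp (- l)\<close>; the second yields \<open>1 + e^2 \<le> s\<close>.\<close>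
  define e where "e = min (exp (- l) / 6) (s - 1)"
  have "e \<le> exp (- l) / 6" unfolding e_def by (rule min.cobounded1)
  then have el: "6 * e \<le> exp (- l)" by simp
  have "exp (- l) \<le> 1" using l by simp
  then have "e \<le> 1 / 2" using el by linarith
  moreover have "0 < e" using s by (simp add: e_def)
  moreover have "e \<le> s - 1" unfolding e_def by (rule min.cobounded2)
  ultimately have e: "0 < e" "e \<le> 1 / 2" "e \<le> s - 1" by auto
  have "e\<^sup>2 \<le> e * 1" unfolding power2_eq_square using e by (intro mult_left_mono) auto
  then have es: "1 + e\<^sup>2 \<le> s" using e by simp
  have lns: "ln s > 0" using s by simp
  \<comment> \<open>This is the least combined gain of the two maps at vectors away from both
    axes.\<close>
  define t where "t = ln (1 + (s\<^sup>2 - 1 / s\<^sup>2)\<^sup>2 * e\<^sup>2 / 4) / 2"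
  have t: "t > 0"
  proof -
    have "s\<^sup>2 > 1" using s by (simp add: one_less_power)
    moreover have "1 / s\<^sup>2 < 1"
      using \<open>s\<^sup>2 > 1\<close> s by (subst pos_divide_less_eq) auto
    ultimately have "s\<^sup>2 - 1 / s\<^sup>2 > 0" by linarith
    then have "(s\<^sup>2 - 1 / s\<^sup>2)\<^sup>2 * e\<^sup>2 / 4 > 0" using e by simp
    then show ?thesis by (simp add: t_def)
  qed
  \<comment> \<open>The entry \<open>ln s / 16\<close> limits the measures of \<open>H\<close> and
    \<open>V\<close> to \<open>17 / 24\<close>, and \<open>t / 2000\<close> limits that of
    \<open>N\<close> to \<open>1 / 1000\<close>.\<close>
  define d where "d = min (ln s / 16) (t / 2000)"
  have d: "d > 0" using lns t by (simp add: d_def)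
  show thesis
  proof (rule that[OF d], rule ccontr)
    fix \<mu> assume \<mu>: "\<mu> \<in> borel_prob_measures_on K" and E: "energy_of \<mu> \<le> ereal C"
    note id[measurable] = borel_prob_measures_onD(3)[OF \<mu>]
    interpret prob_space \<mu> by (rule borel_prob_measures_onD(1)[OF \<mu>])
    interpret P: pair_prob_space \<mu> \<mu> ..
    note sp = borel_prob_measures_onD(2)[OF \<mu>]
    note [measurable] = borel_measurable_fst_snd[OF id]
    let ?P = "\<mu> \<Otimes>\<^sub>M \<mu>"
    let ?A = "\<integral>p. log_gain M (fst p - snd p) \<partial>?P"
      and ?B = "\<integral>p. log_gain (M ** plane_rotation (pi / 2)) (fst p - snd p) \<partial>?P"
    assume "\<not> (d \<le> ?A \<or> d \<le> ?B)"
    then have AB: "?A < d" "?B < d" by auto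
    have iA: "integrable ?P (\<lambda>p. log_gain M (fst p - snd p))"
      by (rule integrable_log_gain[OF \<mu> M])
    have iB: "integrable ?P (\<lambda>p. log_gain (M ** plane_rotation (pi / 2)) (fst p - snd p))"
      by (rule integrable_log_gain[OF \<mu>]) (simp add: det_mul M)
    have fin: "energy_of \<mu> < \<infinity>" using E by auto
    define H where "H = {p \<in> space ?P. \<bar>Y (fst p - snd p)\<bar> < e * \<bar>X (fst p - snd p)\<bar>}"
    define V where "V = {p \<in> space ?P. \<bar>X (fst p - snd p)\<bar> < e * \<bar>Y (fst p - snd p)\<bar>}"
    define N where "N = space ?P - (H \<union> V)"
    define S where "S = {p \<in> space ?P. norm (fst p - snd p) \<le> D * exp (- l)}"
    have [measurable]: "H \<in> sets ?P" "V \<in> sets ?P" "S \<in> sets ?P"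
      unfolding H_def V_def S_def by measurable
    then have [measurable]: "N \<in> sets ?P" unfolding N_def by auto
    have tri: "(y, z) \<in> N \<or> (x, y) \<in> S \<or> (x, z) \<in> S"
      if xy: "(x, y) \<in> H" and xz: "(x, z) \<in> V" for x y z
    proof (rule ccontr)
      assume *: "\<not> ?thesis"
      have K: "x \<in> K" "y \<in> K" "z \<in> K"
        using xy xz by (auto simp: H_def V_def space_pair_measure sp)
      have 1: "\<bar>Y (x - y)\<bar> < e * \<bar>X (x - y)\<bar>" and 2: "\<bar>X (x - z)\<bar> < e * \<bar>Y (x - z)\<bar>"
        using xy xz by (auto simp: H_def V_def)
      have "(y, z) \<in> H \<or> (y, z) \<in> V"
        using * K by (auto simp: N_def space_pair_measure sp)
      \<comment> \<open>If the edge \<open>(y, z)\<close> is near the first axis, then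
        \<open>(x, z)\<close> is the short edge; if it is near the second, then
        \<open>(x, y)\<close> is.\<close>
      then have "norm (x - y) \<le> 6 * e * D \<or> norm (x - z) \<le> 6 * e * D"
      proof
        assume "(y, z) \<in> H"
        then have "\<bar>Y (x - z) - Y (x - y)\<bar> < e * \<bar>X (x - z) - X (x - y)\<bar>"
          by (simp add: H_def Xd)
        then have "norm (x - z) \<le> 6 * e * \<bar>X (x - y)\<bar>"
          using near_axes_triangle[OF e(1,2) 1 2] nXY[of "x - z"] by linarith
        also have "\<dots> \<le> 6 * e * D"
          using Xn[of "x - y"] D(2) K e by (intro mult_left_mono) (auto intro: order_trans)
        finally show ?thesis ..
      next
        assume "(y, z) \<in> V"
        then have "\<bar>X (x - y) - X (x - z)\<bar> < e * \<bar>Y (x - y) - Y (x - z)\<bar>"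
          by (simp add: V_def Xd abs_minus_commute)
        then have "norm (x - y) \<le> 6 * e * \<bar>Y (x - z)\<bar>"
          using near_axes_triangle[OF e(1,2) 2 1] nXY[of "x - y"] by linarith
        also have "\<dots> \<le> 6 * e * D"
          using Yn[of "x - z"] D(2) K e by (intro mult_left_mono) (auto intro: order_trans)
        finally show ?thesis ..
      qed
      moreover have "6 * e * D \<le> D * exp (- l)"
        using mult_right_mono[OF el, of D] D(1) by (simp add: mult.commute)
      ultimately show False
        using * K by (auto simp: S_def space_pair_measure sp)
    qed
    have "emeasure ?P H * emeasure ?P V \<le> 3 * emeasure ?P N + 4 * emeasure ?P S"
    proof (rule emeasure_mult_le_of_triangles[OF prob_space_axioms])
      show "(y, x) \<in> H" if "(x, y) \<in> H" for x y
        using that by (auto simp: H_def Xd space_pair_measure abs_minus_commute)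
    qed (use tri in \<open>auto simp: N_def\<close>)
    then have "ennreal (measure ?P H * measure ?P V) \<le> ennreal (3 * measure ?P N + 4 * measure ?P S)"
      by (simp add: P.emeasure_eq_measure ennreal_mult ennreal_plus)
    then have prod: "measure ?P H * measure ?P V \<le> 3 * measure ?P N + 4 * measure ?P S"
      by (subst (asm) ennreal_le_iff) auto
    have "measure ?P S \<le> (ln D + C) / l"
      unfolding S_def by (rule measure_close_le[OF \<mu> D E l])
    also have "\<dots> \<le> 1 / 100"
      using l lnD unfolding l_def by (simp add: pos_divide_le_eq)
    finally have S: "measure ?P S \<le> 1 / 100" .
    \<comment> \<open>A function at least \<open>ln s / 2\<close> on \<open>Q\<close> and at least
      \<open>- ln s\<close> elsewhere dominates
      \<open>3 / 2 * ln s * indicator Q - ln s\<close>.\<close>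
    have bound: "3 / 2 * ln s * measure ?P Q - ln s \<le> (\<integral>p. f p \<partial>?P)"
      if [measurable]: "Q \<in> sets ?P" and f: "integrable ?P f"
        and fQ: "\<And>p. p \<in> Q \<Longrightarrow> f p \<ge> ln s / 2" and f0: "\<And>p. f p \<ge> - ln s" for Q and f :: "_ \<Rightarrow> real"
    proof -
      have iQ: "integrable ?P (\<lambda>p. 3 / 2 * ln s * indicator Q p)"
        by (intro integrable_mult_right integrable_real_indicator) (auto simp: P.emeasure_eq_measure)
      have "3 / 2 * ln s * measure ?P Q - ln s = (\<integral>p. 3 / 2 * ln s * indicator Q p - ln s \<partial>?P)"
        unfolding Bochner_Integration.integral_diff[OF iQ P.integrable_const]
        by (simp add: P.prob_space)
      also have "\<dots> \<le> (\<integral>p. f p \<partial>?P)"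
      proof (intro integral_mono f Bochner_Integration.integrable_diff[OF iQ P.integrable_const])
        fix p
        show "3 / 2 * ln s * indicator Q p - ln s \<le> f p"
          using fQ[of p] f0[of p] by (cases "p \<in> Q") simp_all
      qed
      finally show ?thesis .
    qed
    have "3 / 2 * ln s * measure ?P H - ln s \<le> ?A"
    proof (rule bound)
      show "log_gain M (fst p - snd p) \<ge> ln s / 2" if "p \<in> H" for p
        using that s unfolding gA H_def X_def Y_def
        by (intro axis_gain_near_axis[OF _ es]) simp_all
      show "log_gain M (fst p - snd p) \<ge> - ln s" for p
        unfolding gA using s by (intro axis_gain_ge) simp
    qed (use iA in simp_all)
    moreover have "3 / 2 * ln s * measure ?P V - ln s \<le> ?B"
    proof (rule bound)
      show "log_gain (M ** plane_rotation (pi / 2)) (fst p - snd p) \<ge> ln s / 2" if "p \<in> V" for p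
        using that s unfolding gB V_def X_def Y_def
        by (intro axis_gain_near_axis[OF _ es]) simp_all
      show "log_gain (M ** plane_rotation (pi / 2)) (fst p - snd p) \<ge> - ln s" for p
        unfolding gB using s by (intro axis_gain_ge) simp
    qed (use iB in simp_all)
    moreover have "d \<le> ln s / 16" by (simp add: d_def)
    ultimately have "ln s * measure ?P H \<le> ln s * (17 / 24)" "ln s * measure ?P V \<le> ln s * (17 / 24)"
      using AB by auto
    then have HV: "measure ?P H \<le> 17 / 24" "measure ?P V \<le> 17 / 24"
      using lns by (simp_all only: mult_le_cancel_left_pos)
    have "t * measure ?P N = (\<integral>p. t * indicator N p \<partial>?P)" by simp
    also have "\<dots> \<le> (\<integral>p. log_gain M (fst p - snd p) + log_gain (M ** plane_rotation (pi / 2)) (fst p - snd p) \<partial>?P)"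
    proof (rule integral_mono_AE)
      show "AE p in ?P. t * indicator N p \<le>
          log_gain M (fst p - snd p) + log_gain (M ** plane_rotation (pi / 2)) (fst p - snd p)"
        using finite_energyD(1)[OF \<mu> D fin]
      proof (rule AE_mp, intro AE_I2 impI)
        fix p :: "(real ^ 2) \<times> (real ^ 2)" assume p: "p \<in> space ?P" "fst p \<noteq> snd p"
        define w where "w = fst p - snd p"
        have "w \<noteq> 0" using p by (simp add: w_def)
        then have nz: "X w \<noteq> 0 \<or> Y w \<noteq> 0" using nXY[of w] by auto
        have s1: "s \<ge> 1" using s by simp
        \<comment> \<open>It is used with \<open>u = e\<close> on \<open>N\<close> and with
          \<open>u = 0\<close> elsewhere, where it says that the combined gain is
          nonnegative.\<close>
        have ge: "ln (1 + (s\<^sup>2 - 1 / s\<^sup>2)\<^sup>2 * u\<^sup>2 / 4) / 2 \<le> log_gain M w + log_gain (M ** plane_rotation (pi / 2)) w"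
          if "0 \<le> u" "u \<le> 1" "u * \<bar>X w\<bar> \<le> \<bar>Y w\<bar>" "u * \<bar>Y w\<bar> \<le> \<bar>X w\<bar>" for u
          unfolding gA gB using axis_gain_add_ge[OF s1 nz that] by (simp add: X_def Y_def)
        show "t * indicator N p \<le> log_gain M (fst p - snd p) + log_gain (M ** plane_rotation (pi / 2)) (fst p - snd p)"
        proof (cases "p \<in> N")
          case True
          then have "e * \<bar>X w\<bar> \<le> \<bar>Y w\<bar>" "e * \<bar>Y w\<bar> \<le> \<bar>X w\<bar>"
            by (auto simp: N_def H_def V_def w_def)
          then show ?thesis using ge[of e] e True by (simp add: t_def w_def)
        next
          case False
          then show ?thesis using ge[of 0] by (simp add: w_def)
        qed
      qed
      show "integrable ?P (\<lambda>p. t * indicator N p)"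
        by (intro integrable_mult_right integrable_real_indicator) (auto simp: P.emeasure_eq_measure)
    qed (use iA iB in auto)
    also have "\<dots> = ?A + ?B" by (rule Bochner_Integration.integral_add[OF iA iB])
    also have "\<dots> \<le> t * (1 / 1000)" using AB by (simp add: d_def)
    finally have N: "measure ?P N \<le> 1 / 1000" using t by (simp only: mult_le_cancel_left_pos)
    have "1 = measure ?P (N \<union> (H \<union> V))"
    proof -
      have "N \<union> (H \<union> V) = space ?P" by (auto simp: N_def H_def V_def)
      then show ?thesis by (simp add: P.prob_space)
    qed
    also have "\<dots> \<le> measure ?P N + measure ?P (H \<union> V)" by (intro measure_Un_le) auto
    also have "\<dots> \<le> measure ?P N + (measure ?P H + measure ?P V)"
      by (intro add_mono order_refl measure_Un_le) auto
    finally have "measure ?P H \<ge> 1 / 4" "measure ?P V \<ge> 1 / 4"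
      using N HV by linarith+
    \<comment> \<open>The lower bound \<open>1 / 16\<close> exceeds
      \<open>3 / 1000 + 4 / 100\<close>, the largest value that the triangle estimate
      allows.\<close>
    then have "measure ?P H * measure ?P V \<ge> 1 / 4 * (1 / 4)" by (intro mult_mono) auto
    then show False using prod S N by linarith
  qed
qed

lemma log_energy_image_less_quarter_turn:
  assumes K: "bounded K" and sym: "(*v) (plane_rotation (pi / 2)) ` K = K"
    and fin: "log_energy K < \<infinity>" and M: "\<bar>det M\<bar> = 1" "\<not> orthogonal_matrix M"
  shows "log_energy ((*v) M ` K) < log_energy K"
proof -
  obtain v where v: "log_energy K = ereal v"
    using fin bounded_imp_log_energy_gt[OF K] by (cases "log_energy K") auto
  obtain d where d: "d > 0" "\<And>\<mu>. \<mu> \<in> borel_prob_measures_on K \<Longrightarrow> energy_of \<mu> \<le> ereal (v + 1) \<Longrightarrow>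
    d \<le> (\<integral>p. log_gain M (fst p - snd p) \<partial>(\<mu> \<Otimes>\<^sub>M \<mu>)) \<or>
    d \<le> (\<integral>p. log_gain (M ** plane_rotation (pi / 2)) (fst p - snd p) \<partial>(\<mu> \<Otimes>\<^sub>M \<mu>))"
    using quarter_turn_gain[OF K M, of "v + 1"] by blast
  have img: "(*v) (M ** plane_rotation (pi / 2)) ` K = (*v) M ` K"
  proof -
    have "(*v) (M ** plane_rotation (pi / 2)) ` K = (*v) M ` (*v) (plane_rotation (pi / 2)) ` K"
      unfolding image_image matrix_vector_mul_assoc ..
    then show ?thesis unfolding sym .
  qed
  have det: "\<bar>det (M ** plane_rotation (pi / 2))\<bar> = 1" using M by (simp add: det_mul)
  have "log_energy ((*v) M ` K) \<le> log_energy K - ereal d"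
  proof (rule log_energy_image_le[OF K, of "v + 1"])
    show "log_energy K < ereal (v + 1)" using v by simp
    fix \<mu> assume "\<mu> \<in> borel_prob_measures_on K" and "energy_of \<mu> \<le> ereal (v + 1)"
    from d(2)[OF this] show "\<exists>T. (*v) T ` K = (*v) M ` K \<and> \<bar>det T\<bar> = 1 \<and>
        d \<le> (\<integral>p. log_gain T (fst p - snd p) \<partial>(\<mu> \<Otimes>\<^sub>M \<mu>))"
      using img det M(1) by blast
  qed
  also have "log_energy K - ereal d < log_energy K"
    using d(1) by (simp add: v)
  finally show ?thesis .
qed

section \<open>The theorem\<close>

text \<open>Replacing \<open>w\<close> by its rotation by \<open>\<psi>\<close> rotates \<open>cnj w / w\<close> by \<open>- 2 * \<psi>\<close>, so it is the double angle that has
  to generate the roots of unity. For odd \<open>N\<close> all \<open>N\<close>-th roots are reached, for even \<open>N\<close> only those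
  of order \<open>N / 2\<close>.\<close>

lemma rotational_symmetry_half_angle:
  assumes "N \<ge> 3" and "rotational_symmetry N K"
  obtains m \<psi> where "m \<ge> 2" and "cis (2 * \<psi>) = cis (2 * pi / real m)"
    and "(*v) (plane_rotation \<psi>) ` K = K" and "m = 2 \<Longrightarrow> \<psi> = pi / 2"
proof (cases "even N")
  case True
  then obtain m where m: "N = 2 * m" by blast
  show thesis
  proof (rule that[of m "2 * pi / real N"])
    show "m \<ge> 2" using assms(1) m by simp
  qed (use assms(2) m in \<open>auto simp: rotational_symmetry_def\<close>)
next
  case False
  then obtain k where k: "N = 2 * k + 1" by (metis oddE)
  \<comment> \<open>Since \<open>2 * (k + 1) = N + 1\<close>, doubling this angle gives
    \<open>2 * pi / N\<close> up to a full turn.\<close>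
  let ?\<psi> = "real (k + 1) * (2 * pi / real N)"
  show thesis
  proof (rule that[of N ?\<psi>])
    have "2 * ?\<psi> = 2 * pi + 2 * pi / real N"
      by (simp add: k field_simps)
    then have "cis (2 * ?\<psi>) = cis (2 * pi) * cis (2 * pi / real N)"
      unfolding cis_mult by (simp only:)
    then show "cis (2 * ?\<psi>) = cis (2 * pi / real N)" by simp
    show "(*v) (plane_rotation ?\<psi>) ` K = K"
      using assms(2) by (intro plane_rotation_multiple_image) (simp add: rotational_symmetry_def)
  qed (use assms(1) in auto)
qed

lemma log_capacity_le_iff:
  assumes "bounded K" and "log_energy K < \<infinity>" and "bounded L"
    and "log_energy L < \<infinity>"
  shows "log_capacity K \<le> log_capacity L \<longleftrightarrow> log_energy L \<le> log_energy K"
  using assms(2,4) bounded_imp_log_energy_gt[OF assms(1)] bounded_imp_log_energy_gt[OF assms(3)]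
  by (cases "log_energy K"; cases "log_energy L") (auto simp: log_capacity_def)

theorem corollary1p2:
  fixes K :: "(real ^ 2) set" and N :: nat
  assumes "compact K" and "N \<ge> 3" and "rotational_symmetry N K"
  shows "(log_capacity K > 0 \<longrightarrow>
            (\<forall>M :: real ^ 2 ^ 2. det M = 1 \<or> det M = -1 \<longrightarrow>
               log_capacity ((*v) M ` K) \<ge> log_capacity K \<and>
               (log_capacity ((*v) M ` K) = log_capacity K \<longleftrightarrow> orthogonal_matrix M))) \<and>
         (measure lebesgue K > 0 \<longrightarrow>
            (\<forall>L :: real ^ 2 ^ 2. measure lebesgue ((*v) L ` K) = measure lebesgue K \<longrightarrow>
               log_capacity K \<le> log_capacity ((*v) L ` K)))"
proof -
  have K: "bounded K" using assms(1) by (rule compact_imp_bounded)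
  have bd: "bounded ((*v) M ` K)" for M :: "real ^ 2 ^ 2"
    by (intro bounded_linear_image K matrix_vector_mul_bounded_linear)
  obtain m \<psi> where m: "m \<ge> 2" "cis (2 * \<psi>) = cis (2 * pi / real m)"
    and \<psi>: "(*v) (plane_rotation \<psi>) ` K = K" "m = 2 \<Longrightarrow> \<psi> = pi / 2"
    using rotational_symmetry_half_angle[OF assms(2,3)] by blast
  have le: "log_capacity K \<le> log_capacity ((*v) M ` K)"
    and eq: "log_capacity K > 0 \<Longrightarrow>
      log_capacity ((*v) M ` K) = log_capacity K \<longleftrightarrow> orthogonal_matrix M"
    if M: "\<bar>det M\<bar> = 1" for M
  proof -
    show "log_capacity K \<le> log_capacity ((*v) M ` K)"
    proof (cases "log_energy K < \<infinity>")
      case True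
      note le = log_energy_image_le_rotational(1)[OF K \<psi>(1) True M m]
      then have "log_energy ((*v) M ` K) < \<infinity>" using True by (rule order_le_less_trans)
      with le show ?thesis using log_capacity_le_iff[OF K True bd] by blast
    qed (simp add: log_capacity_def)
    assume pos: "log_capacity K > 0"
    then have fin: "log_energy K < \<infinity>" by (auto simp: log_capacity_def split: if_splits)
    show "log_capacity ((*v) M ` K) = log_capacity K \<longleftrightarrow> orthogonal_matrix M"
    proof
      assume "orthogonal_matrix M"
      then show "log_capacity ((*v) M ` K) = log_capacity K"
        by (simp add: log_capacity_def log_energy_orthogonal_image[OF K])
    next
      assume cap: "log_capacity ((*v) M ` K) = log_capacity K"
      show "orthogonal_matrix M"
      proof (rule ccontr)
        assume no: "\<not> orthogonal_matrix M"
        have less: "log_energy ((*v) M ` K) < log_energy K"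
        \<comment> \<open>For \<open>m = 2\<close> the angle is a quarter turn, where the product
          formula gives no strict gain and the triangle argument takes over.\<close>
        proof (cases "m = 2")
          case True
          then show ?thesis
            using log_energy_image_less_quarter_turn[OF K _ fin M no] \<psi> by simp
        next
          case False
          then show ?thesis
            using log_energy_image_le_rotational(2)[OF K \<psi>(1) fin M m] m no by simp
        qed
        then have "log_energy ((*v) M ` K) < \<infinity>" using fin by (rule less_trans)
        then show False
          using log_capacity_le_iff[OF bd[of M] _ K fin] cap less by auto
      qed
    qed
  qed
  \<comment> \<open>A linear map scales area by its absolute determinant, and the area of a compact
    set is finite; if it is positive it can be cancelled.\<close>
  have det: "\<bar>det L\<bar> = 1" if "measure lebesgue K > 0"
    "measure lebesgue ((*v) L ` K) = measure lebesgue K" for L :: "real ^ 2 ^ 2"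
    using measure_linear_image[of "(*v) L" K] lmeasurable_compact[OF assms(1)] that by simp
  show ?thesis
  proof (intro conjI impI allI)
    fix M :: "real ^ 2 ^ 2" assume pos: "log_capacity K > 0" and "det M = 1 \<or> det M = -1"
    then have M: "\<bar>det M\<bar> = 1" by auto
    show "log_capacity ((*v) M ` K) \<ge> log_capacity K" by (rule le[OF M])
    show "log_capacity ((*v) M ` K) = log_capacity K \<longleftrightarrow> orthogonal_matrix M"
      by (rule eq[OF M pos])
  next
    fix L :: "real ^ 2 ^ 2"
    assume "measure lebesgue K > 0" "measure lebesgue ((*v) L ` K) = measure lebesgue K"
    then show "log_capacity K \<le> log_capacity ((*v) L ` K)" by (intro le det)
  qed
qed

end
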